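(* Let $\widetilde{G}$ be a connected $U(\mathbb{Q})$-gain graph of order $n$ with $p(\widetilde{G})=0$ and $c(\widetilde{G})=2$. Then $r(\widetilde{G})=n-2c(\widetilde{G})+1=n-3$ if and only if one of the following holds: (a) the underlying graph of $\widetilde{G}$ is $\infty(p,l,q)$ for some $p,l,q$ with $l$ odd, and each cycle of $\widetilde{G}$ is of Type 1; or (b) the underlying graph of $\widetilde{G}$ is $\theta(p',l',q')$ for some $p',l',q'$ all odd, and each cycle of $\widetilde{G}$ is of Type 1.
   Context: All graphs are finite and simple (no loops or multiple edges). $\mathbb{Q}$ denotes the real quaternions (not the rationals), and $U(\mathbb{Q})=\{q\in\mathbb{Q}:|q|=1\}$. A $U(\mathbb{Q})$-gain graph $\widetilde{G}=(G,U(\mathbb{Q}),\varphi)$ consists of a simple graph $G$ with vertices $v_1,\dots,v_n$ (the underlying graph) and a map $\varphi$ assigning to each ordered pair $(v_i,v_j)$ of adjacent vertices a unit quaternion $\varphi_{v_iv_j}$ with $\varphi_{v_iv_j}=\varphi_{v_jv_i}^{-1}=\overline{\varphi_{v_jv_i}}$. Its adjacency matrix $A(\widetilde{G})=(h_{ij})$ is the $n\times n$ Hermitian quaternion matrix with $h_{ij}=\varphi_{v_iv_j}$ if $v_i,v_j$ are adjacent and $h_{ij}=0$ otherwise. The rank $r(\widetilde{G})$ is the row left rank of $A(\widetilde{G})$, i.e. the maximum number of rows that are left linearly independent over $\mathbb{Q}$. $p(\widetilde{G})$ is the number of pendant vertices (vertices of degree 1), and $c(\widetilde{G})=|E(\widetilde{G})|-|V(\widetilde{G})|+\omega(\widetilde{G})$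 is the cyclomatic number, where $\omega(\widetilde{G})$ is the number of connected components. A cycle of $\widetilde{G}$ with vertices $u_1,\dots,u_m$ in cyclic order ($m\ge 3$) is of Type 1 if $m$ is even and $\varphi_{u_1u_2}\varphi_{u_2u_3}\cdots\varphi_{u_{m-1}u_m}\varphi_{u_mu_1}=(-1)^{m/2}$ (this does not depend on the starting vertex or direction). $\infty(p,l,q)$ ($p,q\geq 3$, $l\geq1$): take vertex-disjoint cycles $C_p$, $C_q$ (on $p$ and $q$ vertices) with $v\in V(C_p)$, $u\in V(C_q)$, and a path $P_l=v_1v_2\cdots v_l$ on $l$ vertices; identify $v$ with $v_1$ and $u$ with $v_l$. For $l=1$ this means that $v$ and $u$ are identified. $\theta(p',l',q')$ ($p',l',q'\ge 0$, at most one of them equal to $0$): the graph obtained from three paths on $p'+2$, $l'+2$, $q'+2$ vertices by identifying their three initial vertices into one vertex and their three terminal vertices into one vertex. *)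

theory Defs
  imports Complex_Main "Graph_Theory.Digraph_Isomorphism"
begin

section \<open>Real quaternions\<close>

text \<open>The quaternion \<open>a + b i + c j + d k\<close> is \<open>Quat a b c d\<close>.\<close>

datatype quat = Quat (qRe: real) (qI: real) (qJ: real) (qK: real)

lemma quat_eq_iff:
  "x = y \<longleftrightarrow> qRe x = qRe y \<and> qI x = qI y \<and> qJ x = qJ y \<and> qK x = qK y"
  by (auto intro: quat.expand)

definition qcnj :: "quat \<Rightarrow> quat" where
  "qcnj q = Quat (qRe q) (- qI q) (- qJ q) (- qK q)"

instantiation quat :: division_ring
begin

definition zero_quat where "0 = Quat 0 0 0 0"

definition one_quat where "1 = Quat 1 0 0 0"

definition plus_quat where
  "x + y = Quat (qRe x + qRe y) (qI x + qI y) (qJ x + qJ y) (qK x + qK y)"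

definition minus_quat where
  "x - y = Quat (qRe x - qRe y) (qI x - qI y) (qJ x - qJ y) (qK x - qK y)"

definition uminus_quat where
  "- x = Quat (- qRe x) (- qI x) (- qJ x) (- qK x)"

definition times_quat where
  "x * y = Quat
     (qRe x * qRe y - qI x * qI y - qJ x * qJ y - qK x * qK y)
     (qRe x * qI y + qI x * qRe y + qJ x * qK y - qK x * qJ y)
     (qRe x * qJ y - qI x * qK y + qJ x * qRe y + qK x * qI y)
     (qRe x * qK y + qI x * qJ y - qJ x * qI y + qK x * qRe y)"

definition inverse_quat where
  "inverse x = (let N = (qRe x)\<^sup>2 + (qI x)\<^sup>2 + (qJ x)\<^sup>2 + (qK x)\<^sup>2
                in Quat (qRe x / N) (- qI x / N) (- qJ x / N) (- qK x / N))"

definition divide_quat where "x div y = x * inverse (y :: quat)"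

lemmas quat_defs = zero_quat_def one_quat_def plus_quat_def minus_quat_def uminus_quat_def
  times_quat_def quat_eq_iff

instance
proof
  fix x y :: quat
  let ?N = "(qRe x)\<^sup>2 + (qI x)\<^sup>2 + (qJ x)\<^sup>2 + (qK x)\<^sup>2"
  have N: "?N \<noteq> 0" if "x \<noteq> 0"
    using that by (auto simp: quat_defs add_nonneg_eq_0_iff)
  have eq: "qRe x * (qRe x / ?N) + qI x * (qI x / ?N) + qJ x * (qJ x / ?N) + qK x * (qK x / ?N) = 1"
    if "x \<noteq> 0"
    using N [OF that] by (simp add: power2_eq_square add_divide_distrib [symmetric])
  show "x * inverse x = 1" "inverse x * x = 1" if "x \<noteq> 0"
    using eq [OF that] by (simp_all add: quat_defs inverse_quat_def Let_def mult.commute)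
  show "inverse (0 :: quat) = 0" by (simp add: inverse_quat_def zero_quat_def)
qed (auto simp: quat_defs divide_quat_def algebra_simps)

end

instantiation quat :: real_normed_div_algebra
begin

definition scaleR_quat where
  "scaleR r x = Quat (r * qRe x) (r * qI x) (r * qJ x) (r * qK x)"

definition norm_quat where
  "norm x = sqrt ((qRe x)\<^sup>2 + (qI x)\<^sup>2 + (qJ x)\<^sup>2 + (qK x)\<^sup>2)"

definition sgn_quat where "sgn (x :: quat) = scaleR (inverse (norm x)) x"

definition dist_quat where "dist x (y :: quat) = norm (x - y)"

definition uniformity_quat where
  "(uniformity :: (quat \<times> quat) filter) = (INF e\<in>{0<..}. principal {(x, y). dist x y < e})"

definition open_quat where
  "open (U :: quat set) \<longleftrightarrow> (\<forall>x\<in>U. eventually (\<lambda>(x', y). x' = x \<longrightarrow> y \<in> U) uniformity)"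

instance
proof
  fix x y :: quat and r s :: real and U :: "quat set"
  show "norm x = 0 \<longleftrightarrow> x = 0"
    by (auto simp: norm_quat_def quat_defs add_nonneg_eq_0_iff)
  show "norm (x + y) \<le> norm x + norm y"
  proof -
    have tri: "sqrt ((a + a')\<^sup>2 + (b + b')\<^sup>2) \<le> sqrt (a\<^sup>2 + b\<^sup>2) + sqrt (a'\<^sup>2 + b'\<^sup>2)" for a a' b b' :: real
      by (rule real_sqrt_sum_squares_triangle_ineq)
    have "norm (x + y) =
        sqrt ((sqrt ((qRe x + qRe y)\<^sup>2 + (qI x + qI y)\<^sup>2))\<^sup>2 + (sqrt ((qJ x + qJ y)\<^sup>2 + (qK x + qK y)\<^sup>2))\<^sup>2)"
      by (simp add: norm_quat_def plus_quat_def add.assoc)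
    also have "\<dots> \<le> sqrt ((sqrt ((qRe x)\<^sup>2 + (qI x)\<^sup>2) + sqrt ((qRe y)\<^sup>2 + (qI y)\<^sup>2))\<^sup>2 +
        (sqrt ((qJ x)\<^sup>2 + (qK x)\<^sup>2) + sqrt ((qJ y)\<^sup>2 + (qK y)\<^sup>2))\<^sup>2)"
      by (intro real_sqrt_le_mono add_mono power_mono tri) auto
    also have "\<dots> \<le> norm x + norm y"
      by (rule order_trans [OF tri]) (simp add: norm_quat_def add.assoc)
    finally show ?thesis .
  qed
  show "norm (r *\<^sub>R x) = \<bar>r\<bar> * norm x"
    by (simp add: norm_quat_def scaleR_quat_def power_mult_distrib distrib_left [symmetric]
        real_sqrt_mult)
  show "norm (x * y) = norm x * norm y"
    unfolding norm_quat_def real_sqrt_mult [symmetric]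
    by (rule arg_cong [of _ _ sqrt]) (simp add: times_quat_def power2_eq_square algebra_simps)
qed (auto simp: scaleR_quat_def quat_defs algebra_simps sgn_quat_def dist_quat_def
    uniformity_quat_def open_quat_def)

end

lemma inverse_unit_quat: "norm q = 1 \<Longrightarrow> inverse q = qcnj q"
  by (simp add: norm_quat_def inverse_quat_def qcnj_def)


section \<open>Gain graphs over the unit quaternions\<close>

text \<open>
  A finite simple graph is a \<^locale>\<open>pair_graph\<close>: a finite loop-free symmetric digraph without
  parallel arcs. Each undirected edge \<open>uv\<close> is represented by the two arcs \<open>(u, v)\<close> and \<open>(v, u)\<close>.
  Values of \<open>\<phi>\<close> outside the arc set are irrelevant.
\<close>

locale quat_gain_graph = pair_graph G
  for G :: "'v pair_pre_digraph" +
  fixes \<phi> :: "'v \<times> 'v \<Rightarrow> quat"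
  assumes gain_unit: "(u, v) \<in> parcs G \<Longrightarrow> norm (\<phi> (u, v)) = 1"
    and gain_inverse: "(u, v) \<in> parcs G \<Longrightarrow> \<phi> (u, v) = inverse (\<phi> (v, u))"
begin

lemma gain_qcnj: "(u, v) \<in> parcs G \<Longrightarrow> \<phi> (u, v) = qcnj (\<phi> (v, u))"
  by (metis gain_inverse gain_unit inverse_unit_quat arcs_symmetric)

end

definition adj_matrix :: "'v pair_pre_digraph \<Rightarrow> ('v \<times> 'v \<Rightarrow> quat) \<Rightarrow> 'v \<Rightarrow> 'v \<Rightarrow> quat" where
  "adj_matrix G \<phi> u v = (if (u, v) \<in> parcs G then \<phi> (u, v) else 0)"

text \<open>Matrices have rows and columns indexed by a finite set \<open>V\<close>; the rows are indexed families,
  so two equal rows at different indices are dependent.\<close>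

definition left_indep_rows :: "'v set \<Rightarrow> ('v \<Rightarrow> 'v \<Rightarrow> quat) \<Rightarrow> 'v set \<Rightarrow> bool" where
  "left_indep_rows V A S \<longleftrightarrow>
     (\<forall>c. (\<forall>j\<in>V. (\<Sum>i\<in>S. c i * A i j) = 0) \<longrightarrow> (\<forall>i\<in>S. c i = 0))"

definition row_left_rank :: "'v set \<Rightarrow> ('v \<Rightarrow> 'v \<Rightarrow> quat) \<Rightarrow> nat" where
  "row_left_rank V A = Max {card S | S. S \<subseteq> V \<and> left_indep_rows V A S}"

definition gain_rank :: "'v pair_pre_digraph \<Rightarrow> ('v \<times> 'v \<Rightarrow> quat) \<Rightarrow> nat" where
  "gain_rank G \<phi> = row_left_rank (pverts G) (adj_matrix G \<phi>)"

definition pendant_number :: "'v pair_pre_digraph \<Rightarrow> nat" where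
  "pendant_number G = card {v \<in> pverts G. out_degree (with_proj G) v = 1}"

definition undirected_edges :: "'v pair_pre_digraph \<Rightarrow> 'v set set" where
  "undirected_edges G = {{u, v} | u v. (u, v) \<in> parcs G}"

text \<open>For symmetric digraphs the strongly connected components are the connected components.\<close>

definition cyclomatic_number :: "'v pair_pre_digraph \<Rightarrow> int" where
  "cyclomatic_number G =
     int (card (undirected_edges G)) - int (card (pverts G)) + int (card (pre_digraph.sccs (with_proj G)))"

text \<open>
  \<^const>\<open>pre_digraph.cycle\<close> describes a cycle by its list \<open>[(u\<^sub>1, u\<^sub>2), (u\<^sub>2, u\<^sub>3), \<dots>, (u\<^sub>m, u\<^sub>1)]\<close> of arcs
  with distinct \<open>u\<^sub>1, \<dots>, u\<^sub>m\<close>. The length restriction excludes traversing one edge back and forth.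
\<close>

definition graph_cycle :: "'v pair_pre_digraph \<Rightarrow> ('v \<times> 'v) list \<Rightarrow> bool" where
  "graph_cycle G p \<longleftrightarrow> pre_digraph.cycle (with_proj G) p \<and> length p \<ge> 3"

definition type1 :: "('v \<times> 'v \<Rightarrow> quat) \<Rightarrow> ('v \<times> 'v) list \<Rightarrow> bool" where
  "type1 \<phi> p \<longleftrightarrow> even (length p) \<and> prod_list (map \<phi> p) = (- 1) ^ (length p div 2)"


section \<open>The graphs \<open>\<infinity>(p, l, q)\<close> and \<open>\<theta>(p', l', q')\<close>\<close>

definition cycle_graph :: "nat \<Rightarrow> nat pair_pre_digraph" where
  "cycle_graph n = \<lparr> pverts = {..<n},
     parcs = {(i, j). i < n \<and> j < n \<and> (j = Suc i mod n \<or> i = Suc j mod n)} \<rparr>"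

definition path_graph :: "nat \<Rightarrow> nat pair_pre_digraph" where
  "path_graph n = \<lparr> pverts = {..<n},
     parcs = {(i, j). i < n \<and> j < n \<and> (j = Suc i \<or> i = Suc j)} \<rparr>"

text \<open>Vertex-disjoint union of three graphs; the first component of a vertex says which copy it is in.\<close>

definition disjoint_union3 ::
  "'a pair_pre_digraph \<Rightarrow> 'a pair_pre_digraph \<Rightarrow> 'a pair_pre_digraph \<Rightarrow> (nat \<times> 'a) pair_pre_digraph" where
  "disjoint_union3 G0 G1 G2 =
     \<lparr> pverts = {0} \<times> pverts G0 \<union> {1} \<times> pverts G1 \<union> {2} \<times> pverts G2,
       parcs = {((0, x), (0, y)) | x y. (x, y) \<in> parcs G0} \<union>
               {((1, x), (1, y)) | x y. (x, y) \<in> parcs G1} \<union>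
               {((2, x), (2, y)) | x y. (x, y) \<in> parcs G2} \<rparr>"

text \<open>Identification of the vertices having the same image under \<open>f\<close>.\<close>

definition identify :: "('a \<Rightarrow> 'b) \<Rightarrow> 'a pair_pre_digraph \<Rightarrow> 'b pair_pre_digraph" where
  "identify f G = \<lparr> pverts = f ` pverts G, parcs = map_prod f f ` parcs G \<rparr>"

text \<open>Copy 0 is \<open>C\<^sub>p\<close>, copy 1 is \<open>P\<^sub>l\<close> and copy 2 is \<open>C\<^sub>q\<close>; vertex 0 of \<open>C\<^sub>p\<close> is identified with the
  initial vertex of \<open>P\<^sub>l\<close> and vertex 0 of \<open>C\<^sub>q\<close> with its terminal vertex \<open>l - 1\<close>.\<close>

definition infinity_graph :: "nat \<Rightarrow> nat \<Rightarrow> nat \<Rightarrow> (nat \<times> nat) pair_pre_digraph" where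
  "infinity_graph p l q =
     identify (\<lambda>x. if x = (0, 0) then (1, 0) else if x = (2, 0) then (1, l - 1) else x)
       (disjoint_union3 (cycle_graph p) (path_graph l) (cycle_graph q))"

text \<open>All initial vertices are identified with \<open>(0, 0)\<close>, and all terminal vertices with the terminal
  vertex \<open>(0, p + 1)\<close> of copy 0.\<close>

definition theta_graph :: "nat \<Rightarrow> nat \<Rightarrow> nat \<Rightarrow> (nat \<times> nat) pair_pre_digraph" where
  "theta_graph p l q =
     identify (\<lambda>x. if x \<in> {(0, 0), (1, 0), (2, 0)} then (0, 0)
                   else if x \<in> {(0, p + 1), (1, l + 1), (2, q + 1)} then (0, p + 1) else x)
       (disjoint_union3 (path_graph (p + 2)) (path_graph (l + 2)) (path_graph (q + 2)))"

definition is_infinity :: "'v pair_pre_digraph \<Rightarrow> nat \<Rightarrow> nat \<Rightarrow> nat \<Rightarrow> bool" where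
  "is_infinity G p l q \<longleftrightarrow> p \<ge> 3 \<and> q \<ge> 3 \<and> l \<ge> 1 \<and>
     digraph_iso (with_proj G) (with_proj (infinity_graph p l q))"

definition is_theta :: "'v pair_pre_digraph \<Rightarrow> nat \<Rightarrow> nat \<Rightarrow> nat \<Rightarrow> bool" where
  "is_theta G p l q \<longleftrightarrow> \<not> (p = 0 \<and> l = 0) \<and> \<not> (p = 0 \<and> q = 0) \<and> \<not> (l = 0 \<and> q = 0) \<and>
     digraph_iso (with_proj G) (with_proj (theta_graph p l q))"

end

theory Submission
  imports Defs
begin

text \<open>
  A suitable longest path \<open>x\<^sub>0, \<dots>, x\<^sub>k\<close> of \<open>G\<close> is Hamiltonian: both ends have a further neighbour on the path,
  \<open>x\<^sub>0 x\<^sub>i\<close> and \<open>x\<^sub>j x\<^sub>k\<close> say, these two chords already produce cyclomatic number two, and so the degree sum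
  leaves no room for anything else. The graph is \<open>\<infinity>(i + 1, j - i + 1, k - j + 1)\<close> if \<open>i \<le> j\<close> and
  \<open>\<theta>(i - j - 1, j, k - i)\<close> otherwise.

  The equations of a left kernel vector \<open>c\<close> at the path vertices determine \<open>c\<close> from its values at
  \<open>x\<^sub>0, x\<^sub>1, x\<^sub>k\<close>, so the rank is at least \<open>n - 3\<close>. If it is \<open>n - 3\<close>, there is a kernel vector with
  \<open>c\<^sub>0 = c\<^sub>k = 0\<close> and \<open>c\<^sub>1 \<noteq> 0\<close>; it vanishes exactly at the even positions, which forces \<open>i\<close>, \<open>j\<close> odd and
  \<open>k\<close> even. All even positions have degree two, and the kernel equations there show that every cycle is
  of Type 1. Conversely, under these parity conditions the Type 1 property of the cycles \<open>x\<^sub>0 \<dots> x\<^sub>i\<close> and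
  \<open>x\<^sub>j \<dots> x\<^sub>k\<close> allows three independent kernel vectors to be written down: one supported on the odd
  positions, one on the even positions before \<open>i\<close> and one on the even positions after \<open>j\<close>.
\<close>

section \<open>Chord form of bicyclic graphs\<close>

text \<open>One normal form for both families: the chords \<open>0 i\<close> and \<open>j k\<close>
  close cycles that share no edge if \<open>i \<le> j\<close>, and share the stretch from
  \<open>j\<close> to \<open>i\<close> otherwise. Working on positions leaves the vertex type to a
  numbering \<open>x\<close>.\<close>

definition chord_arcs :: "nat \<Rightarrow> nat \<Rightarrow> nat \<Rightarrow> (nat \<times> nat) set" where
  "chord_arcs k i j = {(s, t). s \<le> k \<and> t \<le> k \<and>
     (t = Suc s \<or> s = Suc t \<or> s = 0 \<and> t = i \<or> s = i \<and> t = 0 \<or> s = j \<and> t = k \<or> s = k \<and> t = j)}"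

text \<open>Oriented upwards, there are \<open>k\<close> path edges and two chords, and reversal
  doubles them. The bounds keep the chords off the path edges; in the excluded case the two chords
  coincide.\<close>

lemma card_chord_arcs:
  assumes "2 \<le> i" "i \<le> k" "j + 2 \<le> k" "\<not> (i = k \<and> j = 0)"
  shows "card (chord_arcs k i j) = 2 * (k + 2)"
proof -
  define A where "A = (\<lambda>s. (s, Suc s)) ` {..<k} \<union> {(0, i), (j, k)}"
  have A: "finite A" "\<And>s t. (s, t) \<in> A \<Longrightarrow> s < t"
    using assms by (auto simp: A_def)
  have "card ((\<lambda>s. (s, Suc s)) ` {..<k}) = k"
    by (subst card_image) (auto simp: inj_on_def)
  moreover have "(0, i) \<notin> (\<lambda>s. (s, Suc s)) ` {..<k}" "(j, k) \<notin> insert (0, i) ((\<lambda>s. (s, Suc s)) ` {..<k})"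
    using assms by auto
  moreover have "A = insert (j, k) (insert (0, i) ((\<lambda>s. (s, Suc s)) ` {..<k}))"
    by (auto simp: A_def)
  ultimately have cA: "card A = k + 2" by simp
  have "chord_arcs k i j = A \<union> A\<inverse>"
    using assms by (auto simp: chord_arcs_def A_def)
  moreover have "A \<inter> A\<inverse> = {}" using A(2) by (metis converseE disjoint_iff order_less_asym)
  ultimately show ?thesis
    using A(1) cA by (simp add: card_Un_disjoint card_inverse)
qed

section \<open>Longest paths in bicyclic graphs\<close>

definition is_path :: "('v \<times> 'v) set \<Rightarrow> 'v set \<Rightarrow> 'v list \<Rightarrow> bool" where
  "is_path E V xs \<longleftrightarrow> xs \<noteq> [] \<and> distinct xs \<and> set xs \<subseteq> V \<and>
     (\<forall>t. Suc t < length xs \<longrightarrow> (xs ! t, xs ! Suc t) \<in> E)"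

lemma is_path_rev:
  assumes "sym E" "is_path E V xs"
  shows "is_path E V (rev xs)"
  unfolding is_path_def
proof (intro conjI allI impI)
  fix t assume t: "Suc t < length (rev xs)"
  have "(xs ! (length xs - Suc (Suc t)), xs ! Suc (length xs - Suc (Suc t))) \<in> E"
    using assms(2) t by (auto simp: is_path_def)
  moreover have "Suc (length xs - Suc (Suc t)) = length xs - Suc t" using t by auto
  ultimately show "(rev xs ! t, rev xs ! Suc t) \<in> E"
    using t symD [OF assms(1)] by (auto simp: rev_nth)
qed (use assms in \<open>auto simp: is_path_def\<close>)

lemma is_path_Cons:
  assumes "is_path E V xs" "u \<in> V" "u \<notin> set xs" "(u, xs ! 0) \<in> E"
  shows "is_path E V (u # xs)"
  using assms unfolding is_path_def by (auto simp: nth_Cons split: nat.splits)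

text \<open>The path closes up to a cycle, which may be cut open anywhere. The closing arc serves
  the one step whose index wraps round.\<close>

lemma is_path_rotate:
  assumes "is_path E V xs" "(xs ! (length xs - 1), xs ! 0) \<in> E"
  shows "is_path E V (rotate a xs)"
  unfolding is_path_def
proof (intro conjI allI impI)
  fix t assume t: "Suc t < length (rotate a xs)"
  let ?m = "length xs" and ?s = "(a + t) mod length xs"
  have m: "?m > 0" using t by auto
  have s: "?s < ?m" using m by simp
  have *: "(a + Suc t) mod ?m = (if Suc ?s = ?m then 0 else Suc ?s)"
    by (simp add: mod_Suc)
  have "(xs ! ?s, xs ! ((a + Suc t) mod ?m)) \<in> E"
  proof (cases "Suc ?s = ?m")
    case True
    then have "?s = ?m - 1" by linarith
    then show ?thesis using assms(2) * True by simp
  next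
    case False
    then have "Suc ?s < ?m" using s by linarith
    then show ?thesis using assms(1) * False by (simp add: is_path_def)
  qed
  then show "(rotate a xs ! t, rotate a xs ! Suc t) \<in> E"
    using t by (simp add: nth_rotate add.commute)
qed (use assms in \<open>auto simp: is_path_def\<close>)

text \<open>\<open>closed_eq\<close> is connectedness phrased without walks; \<open>card_E\<close>
  is cyclomatic number two of a connected graph, each edge counting as two arcs.\<close>

locale bicyclic_relation =
  fixes V :: "'v set" and E :: "('v \<times> 'v) set"
  assumes finite_V: "finite V" and nonempty_V: "V \<noteq> {}" and E_subset: "E \<subseteq> V \<times> V"
    and sym_E: "sym E" and irrefl_E: "(v, v) \<notin> E"
    and closed_eq: "\<lbrakk>W \<subseteq> V; W \<noteq> {}; E `` W \<subseteq> W\<rbrakk> \<Longrightarrow> W = V"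
    and deg_ge_2: "v \<in> V \<Longrightarrow> 2 \<le> card (E `` {v})"
    and card_E: "card E = 2 * card V + 2"
begin

lemma finite_E: "finite E"
  using E_subset finite_V by (meson finite_SigmaI finite_subset)

lemma finite_nbrs: "finite (E `` {v})"
  using finite_E by (simp add: finite_Image)

lemma card_arcs_from:
  assumes "W \<subseteq> V"
  shows "card (E \<inter> W \<times> UNIV) = (\<Sum>v\<in>W. card (E `` {v}))"
proof -
  have "E \<inter> W \<times> UNIV = (SIGMA v:W. E `` {v})" by auto
  then show ?thesis
    using finite_nbrs finite_subset [OF assms finite_V] by (simp add: card_SigmaI)
qed

text \<open>A subgraph that already has cyclomatic number two is everything: by the degree sum there
  are no further arcs leaving its vertices.\<close>

lemma chord_spanning:
  assumes x: "inj_on x {..k}" "x ` {..k} \<subseteq> V" "map_prod x x ` chord_arcs k i j \<subseteq> E"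
    and ij: "2 \<le> i" "i \<le> k" "j + 2 \<le> k" "\<not> (i = k \<and> j = 0)"
  shows "V = x ` {..k}" "E = map_prod x x ` chord_arcs k i j"
proof -
  let ?W = "x ` {..k}" and ?H = "map_prod x x ` chord_arcs k i j"
  let ?F = "E \<inter> ?W \<times> UNIV" and ?F' = "E \<inter> (V - ?W) \<times> UNIV"
  have W: "card ?W = Suc k" using card_image [OF x(1)] by simp
  have "inj_on (map_prod x x) (chord_arcs k i j)"
    using x(1) by (auto simp: inj_on_def chord_arcs_def)
  then have H: "card ?H = 2 * (k + 2)"
    using card_chord_arcs [OF ij] by (simp add: card_image)
  have sub: "?H \<subseteq> ?F"
    using x(3) by (auto simp: chord_arcs_def)
  have "E = ?F \<union> ?F'" using E_subset by auto
  then have "card E = card ?F + card ?F'"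
    by (subst card_Un_disjoint [symmetric]) (use finite_E in auto)
  moreover have "card ?F' \<ge> 2 * card (V - ?W)"
  proof -
    have "(\<Sum>v\<in>V - ?W. 2) \<le> (\<Sum>v\<in>V - ?W. card (E `` {v}))"
      by (rule sum_mono) (use deg_ge_2 in auto)
    then show ?thesis by (simp add: card_arcs_from)
  qed
  moreover have "card V = card (V - ?W) + Suc k"
    using x(2) W finite_V card_mono [OF finite_V x(2)] by (simp add: card_Diff_subset)
  \<comment> \<open>Vertices outside \<open>?W\<close> use up at least
    \<open>2 * card (V - ?W)\<close> of the \<open>2 * card V + 2\<close> arcs; this leaves at most
    \<open>2 * (k + 2)\<close> for \<open>?W\<close>, exactly the size of \<open>?H\<close>.\<close>
  ultimately have "card ?F \<le> card ?H" using card_E H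
    unfolding distrib_left by linarith
  then have FH: "?H = ?F" using sub finite_E by (intro card_seteq) auto
  have "E `` ?W \<subseteq> ?W"
  proof
    fix v assume "v \<in> E `` ?W"
    then obtain w where "(w, v) \<in> ?F" by auto
    then have "(w, v) \<in> ?H" using FH by simp
    then show "v \<in> ?W" by (auto simp: chord_arcs_def)
  qed
  then show "V = ?W" using closed_eq [of ?W] x(2) by auto
  then show "E = ?H" using FH E_subset by auto
qed

definition longest :: "'v list \<Rightarrow> bool" where
  "longest xs \<longleftrightarrow> is_path E V xs \<and> (\<forall>ys. is_path E V ys \<longrightarrow> length ys \<le> length xs)"

lemma longest_exists: "\<exists>xs. longest xs"
proof -
  obtain v where "v \<in> V" using nonempty_V by auto
  then have "is_path E V [v]" by (simp add: is_path_def)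
  moreover have "\<forall>ys. is_path E V ys \<longrightarrow> length ys < Suc (card V)"
    using card_mono [OF finite_V] by (metis distinct_card is_path_def le_imp_less_Suc)
  ultimately show ?thesis
    using ex_has_greatest_nat [of "is_path E V" "[v]" length "Suc (card V)"] unfolding longest_def by blast
qed

lemma longest_rev: "longest xs \<Longrightarrow> longest (rev xs)"
  using is_path_rev [OF sym_E] by (auto simp: longest_def)

lemma longest_rotate:
  "\<lbrakk>longest xs; (xs ! (length xs - 1), xs ! 0) \<in> E\<rbrakk> \<Longrightarrow> longest (rotate a xs)"
  using is_path_rotate by (auto simp: longest_def)

lemma longest_nbr_start:
  assumes "longest xs" "(xs ! 0, u) \<in> E"
  shows "u \<in> set xs"
proof (rule ccontr)
  assume "u \<notin> set xs"
  then have "is_path E V (u # xs)"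
    using assms E_subset symD [OF sym_E] by (intro is_path_Cons) (auto simp: longest_def)
  then show False using assms(1) by (fastforce simp: longest_def)
qed

text \<open>\<open>F\<close> holds neighbours to be avoided. Degree at least two leaves another one,
  which lies on the path by maximality. An empty \<open>F\<close> bounds the length from below;
  \<open>F = {xs ! 1}\<close> yields a chord.\<close>

lemma longest_chord_start:
  assumes "longest xs" "F \<subseteq> E `` {xs ! 0}" "card F \<le> 1"
  obtains i where "1 \<le> i" "i < length xs" "(xs ! 0, xs ! i) \<in> E" "xs ! i \<notin> F"
proof -
  have "xs ! 0 \<in> V" using assms(1) by (auto simp: longest_def is_path_def)
  then have "2 \<le> card (E `` {xs ! 0})" by (rule deg_ge_2)
  then have "E `` {xs ! 0} \<noteq> F" using assms(3) by auto
  then obtain u where u: "(xs ! 0, u) \<in> E" "u \<notin> F" using assms(2) by auto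
  then obtain i where "i < length xs" "u = xs ! i"
    using longest_nbr_start [OF assms(1)] by (metis in_set_conv_nth)
  moreover then have "i \<noteq> 0" using u irrefl_E by metis
  ultimately show thesis using that [of i] u by simp
qed

lemma longest_length: "longest xs \<Longrightarrow> 2 \<le> length xs"
  using longest_chord_start [of xs "{}"] by fastforce

lemma longest_chord:
  assumes "longest xs"
  obtains i where "2 \<le> i" "i < length xs" "(xs ! 0, xs ! i) \<in> E"
proof -
  have "length xs \<ge> 2" by (rule longest_length) fact
  then have "(xs ! 0, xs ! 1) \<in> E" using assms by (simp add: longest_def is_path_def)
  then obtain i where i: "1 \<le> i" "i < length xs" "(xs ! 0, xs ! i) \<in> E" "xs ! i \<notin> {xs ! 1}"
    using longest_chord_start [OF assms, of "{xs ! 1}"] by auto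
  then have "i \<noteq> 1" by auto
  then show thesis using that [of i] i by simp
qed

text \<open>The path and its reverse each have a chord at the start. They can only be the same edge
  if the path closes up to a cycle; restarting that cycle at a vertex of degree at least three then
  gives a second chord.\<close>

lemma longest_two_chords:
  "\<exists>xs i j. longest xs \<and> 2 \<le> i \<and> i < length xs \<and> j + 2 < length xs \<and> \<not> (i = length xs - 1 \<and> j = 0) \<and>
     (xs ! 0, xs ! i) \<in> E \<and> (xs ! j, xs ! (length xs - 1)) \<in> E"
proof -
  obtain xs where xs: "longest xs" using longest_exists by blast
  let ?m = "length xs"
  obtain i where i: "2 \<le> i" "i < ?m" "(xs ! 0, xs ! i) \<in> E"
    using longest_chord [OF xs] by blast
  obtain j' where j': "2 \<le> j'" "j' < ?m" "(rev xs ! 0, rev xs ! j') \<in> E"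
    using longest_chord [OF longest_rev [OF xs]] by auto
  define j where "j = ?m - Suc j'"
  have j: "j + 2 < ?m" "(xs ! j, xs ! (?m - 1)) \<in> E"
  proof -
    show "j + 2 < ?m" using j' by (auto simp: j_def)
    have "0 < ?m" using j' by linarith
    then have "rev xs ! 0 = xs ! (?m - 1)" "rev xs ! j' = xs ! j"
      using j' by (simp_all only: rev_nth j_def One_nat_def)
    then show "(xs ! j, xs ! (?m - 1)) \<in> E"
      using j' symD [OF sym_E] by simp
  qed
  show ?thesis
  proof (cases "i = ?m - 1 \<and> j = 0")
    case False
    then show ?thesis using xs i j by blast
  next
    case True
    \<comment> \<open>The longest path closes up to a cycle, so each of its vertices starts a longest path.\<close>
    then have cyc: "(xs ! (?m - 1), xs ! 0) \<in> E" using j symD [OF sym_E] by simp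
    have rot: "longest (rotate a xs)" "(rotate a xs ! 0, rotate a xs ! (?m - 1)) \<in> E" 
      "rotate a xs ! 0 = xs ! a" if "a < ?m" for a
    proof -
      show "longest (rotate a xs)" by (rule longest_rotate) fact+
      have a: "rotate a xs ! 0 = xs ! a" "rotate a xs ! (?m - 1) = xs ! ((?m - 1 + a) mod ?m)"
        using nth_rotate [of 0 xs a] nth_rotate [of "?m - 1" xs a] that
        by (cases xs; simp add: add.commute)+
      show "(rotate a xs ! 0, rotate a xs ! (?m - 1)) \<in> E"
      proof (cases a)
        case 0
        then show ?thesis using a cyc symD [OF sym_E] i by auto
      next
        case (Suc b)
        then have "?m - 1 + a = b + ?m" "b < ?m"
          using that by linarith+
        then have "(?m - 1 + a) mod ?m = b"
          by simp
        then show ?thesis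
          using a xs Suc that symD [OF sym_E] by (auto simp: longest_def is_path_def)
      qed
      show "rotate a xs ! 0 = xs ! a" by (rule a)
    qed
    have "E `` set xs \<subseteq> set xs"
    proof
      fix u assume "u \<in> E `` set xs"
      then obtain a where a: "a < ?m" "(xs ! a, u) \<in> E" by (auto simp: in_set_conv_nth)
      then show "u \<in> set xs" using longest_nbr_start [OF rot(1) [OF a(1)]] rot(3) [OF a(1)] by simp
    qed
    then have V: "set xs = V" using xs by (intro closed_eq) (auto simp: longest_def is_path_def)
    \<comment> \<open>If all degrees were at most two, there would be at most
      \<open>2 * card V\<close> arcs, contradicting \<open>card_E\<close>.\<close>
    have "\<exists>v\<in>V. 3 \<le> card (E `` {v})"
    proof (rule ccontr)
      assume "\<not> ?thesis"
      then have "(\<Sum>v\<in>V. card (E `` {v})) \<le> (\<Sum>v\<in>V. 2)" by (intro sum_mono) force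
      moreover have "E \<inter> V \<times> UNIV = E" using E_subset by auto
      ultimately show False using card_arcs_from [of V] card_E by simp
    qed
    then obtain a where a: "a < ?m" "3 \<le> card (E `` {xs ! a})"
      using V by (metis in_set_conv_nth)
    let ?ys = "rotate a xs"
    note ys = rot [OF a(1)]
    have "\<not> E `` {?ys ! 0} \<subseteq> {?ys ! 1, ?ys ! (?m - 1)}"
    proof
      assume "E `` {?ys ! 0} \<subseteq> {?ys ! 1, ?ys ! (?m - 1)}"
      then have "card (E `` {?ys ! 0}) \<le> card {?ys ! 1, ?ys ! (?m - 1)}" by (rule card_mono [rotated]) simp
      also have "\<dots> \<le> 2" by (simp add: card_insert_if)
      finally show False using a(2) ys(3) by simp
    qed
    then obtain u where u: "(?ys ! 0, u) \<in> E" "u \<noteq> ?ys ! 1" "u \<noteq> ?ys ! (?m - 1)" by auto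
    then obtain c where c: "c < ?m" "u = ?ys ! c"
      using longest_nbr_start [OF ys(1)] by (metis in_set_conv_nth length_rotate)
    have "c \<noteq> 0" "c \<noteq> 1" "c \<noteq> ?m - 1" using u c irrefl_E by metis+
    \<comment> \<open>The new chord goes to position \<open>c\<close>, and the closing edge of the
      cycle is the second chord, with \<open>j = 0\<close>.\<close>
    then have "2 \<le> c \<and> c < length ?ys \<and> 0 + 2 < length ?ys \<and> \<not> (c = length ?ys - 1 \<and> (0::nat) = 0)"
      using c(1) i by auto
    then show ?thesis using ys(1,2) u(1) c(2) by (metis length_rotate)
  qed
qed

lemma chord_form:
  obtains k i j x where "2 \<le> i" "i \<le> k" "j + 2 \<le> k" "inj_on x {..k}" "V = x ` {..k}"
    "E = map_prod x x ` chord_arcs k i j"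
proof -
  obtain xs i j where xs: "longest xs" and ij: "2 \<le> i" "i < length xs" "j + 2 < length xs"
      "\<not> (i = length xs - 1 \<and> j = 0)"
    and E: "(xs ! 0, xs ! i) \<in> E" "(xs ! j, xs ! (length xs - 1)) \<in> E"
    using longest_two_chords by blast
  define k where "k = length xs - 1"
  have k: "length xs = Suc k" using ij by (simp add: k_def)
  have inj: "inj_on ((!) xs) {..k}"
    using xs k by (auto simp: longest_def is_path_def inj_on_def nth_eq_iff_index_eq)
  have sub: "(!) xs ` {..k} \<subseteq> V"
    using xs k by (auto simp: longest_def is_path_def dest!: subsetD)
  have step: "(xs ! t, xs ! Suc t) \<in> E" if "t < k" for t
    using xs k that by (auto simp: longest_def is_path_def)
  have arcs: "map_prod ((!) xs) ((!) xs) ` chord_arcs k i j \<subseteq> E"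
    using E k step symD [OF sym_E] by (auto simp: chord_arcs_def)
  have ij': "2 \<le> i" "i \<le> k" "j + 2 \<le> k" "\<not> (i = k \<and> j = 0)" using ij k by auto
  show thesis
    using that [OF ij'(1-3) inj] chord_spanning [OF inj sub arcs ij'] by blast
qed

end

section \<open>From pair graphs to the relational setting\<close>

lemma (in pair_graph) card_parcs: "card (parcs G) = 2 * card (undirected_edges G)"
proof -
  let ?f = "\<lambda>a. {fst a, snd a}"
  have img: "undirected_edges G = ?f ` parcs G"
    by (force simp: undirected_edges_def)
  have "card {a \<in> parcs G. ?f a = e} = 2" if e: "e \<in> ?f ` parcs G" for e
  proof -
    obtain a where "a \<in> parcs G" "e = {fst a, snd a}" using e by auto
    then obtain u v where uv: "(u, v) \<in> parcs G" "e = {u, v}" by (cases a) auto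
    then have "{a \<in> parcs G. ?f a = e} = {(u, v), (v, u)}"
      using arcs_symmetric by (auto simp: doubleton_eq_iff)
    moreover have "u \<noteq> v" using uv pair_no_loops by fastforce
    ultimately show ?thesis by simp
  qed
  then have "(\<Sum>e\<in>?f ` parcs G. card {a \<in> parcs G. ?f a = e}) = 2 * card (undirected_edges G)"
    by (simp add: img)
  then show ?thesis
    using sum.image_gen [of "parcs G" "\<lambda>_. 1 :: nat" ?f] by simp
qed

lemma (in pair_wf_digraph) out_degree_Image: "out_degree (with_proj G) v = card (parcs G `` {v})"
proof -
  have "out_arcs (with_proj G) v = Pair v ` (parcs G `` {v})"
    by (auto simp: out_arcs_def)
  then show ?thesis by (simp add: out_degree_def card_image inj_on_def)
qed

lemma (in pair_graph) connected_closed_eq: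
  assumes "connected G" "W \<subseteq> pverts G" "W \<noteq> {}" "parcs G `` W \<subseteq> W"
  shows "W = pverts G"
proof -
  have sc: "strongly_connected G"
    using assms(1) symmetric_connected_imp_strongly_connected by blast
  obtain w where w: "w \<in> W" using assms(3) by auto
  have "v \<in> W" if v: "v \<in> pverts G" for v
  proof -
    have "w \<rightarrow>\<^sup>*\<^bsub>with_proj G\<^esub> v" using sc w v assms(2) by (auto simp: strongly_connected_def)
    then show ?thesis
    proof (induction rule: reachable_induct)
      case (step a b)
      then show ?case using assms(4) by auto
    qed (use w in simp)
  qed
  then show ?thesis using assms(2) by auto
qed

text \<open>A connected graph has a single component, so the cyclomatic number determines the number
  of arcs. Degrees are at least two because there are neither pendant nor isolated vertices.\<close>

lemma (in pair_graph) bicyclic_relation_parcs: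
  assumes con: "connected G" and pend: "pendant_number G = 0" and cyc: "cyclomatic_number G = 2"
  shows "bicyclic_relation (pverts G) (parcs G)"
proof
  have sc: "strongly_connected G"
    using con symmetric_connected_imp_strongly_connected by blast
  then have "sccs = {with_proj G}" by (simp add: strongly_connected_eq_iff)
  then show card: "card (parcs G) = 2 * card (pverts G) + 2"
    using cyc by (simp add: cyclomatic_number_def card_parcs)
  show "finite (pverts G)" by (rule pair_finite_verts)
  show "pverts G \<noteq> {}" using sc by (auto simp: strongly_connected_def)
  show "parcs G \<subseteq> pverts G \<times> pverts G" by (auto dest: in_arcsD1 in_arcsD2)
  show "sym (parcs G)" using arcs_symmetric by (auto intro: symI)
  show irr: "(v, v) \<notin> parcs G" for v using pair_no_loops by fastforce
  show "W = pverts G" if "W \<subseteq> pverts G" "W \<noteq> {}" "parcs G `` W \<subseteq> W" for W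
    by (rule connected_closed_eq) fact+
  show "2 \<le> card (parcs G `` {v})" if v: "v \<in> pverts G" for v
  proof -
    have fin: "finite (parcs G `` {v})" using pair_finite_arcs by (simp add: finite_Image)
    \<comment> \<open>Some arc exists, hence a vertex other than \<open>v\<close>; by connectedness
      \<open>{v}\<close> is not closed and \<open>v\<close> is not isolated.\<close>
    have "parcs G \<noteq> {}" using card by auto
    then obtain a b where "(a, b) \<in> parcs G" by auto
    then have "a \<in> pverts G" "b \<in> pverts G" "a \<noteq> b" using irr by (auto dest: in_arcsD1 in_arcsD2)
    then have "{v} \<noteq> pverts G" by (metis singletonD)
    then have "parcs G `` {v} \<noteq> {}"
      using connected_closed_eq [OF con, of "{v}"] v by auto
    then have "card (parcs G `` {v}) \<noteq> 0" using fin by simp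
    moreover have "card (parcs G `` {v}) \<noteq> 1"
      using pend v pair_finite_verts by (simp add: pendant_number_def out_degree_Image)
    ultimately show ?thesis by linarith
  qed
qed

section \<open>Chord forms up to isomorphism\<close>

definition has_chord_form :: "'v pair_pre_digraph \<Rightarrow> nat \<Rightarrow> nat \<Rightarrow> nat \<Rightarrow> (nat \<Rightarrow> 'v) \<Rightarrow> bool" where
  "has_chord_form G k i j x \<longleftrightarrow> inj_on x {..k} \<and> pverts G = x ` {..k} \<and>
     parcs G = map_prod x x ` chord_arcs k i j"

text \<open>A digraph isomorphism carries a separate map on arcs. With tail \<open>fst\<close> and
  head \<open>snd\<close> on both sides, the vertex map forces it to be
  \<open>map_prod f f\<close>.\<close>

lemma digraph_iso_with_proj:
  assumes "pair_wf_digraph G"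
  shows "digraph_iso (with_proj G) (with_proj H) \<longleftrightarrow>
    (\<exists>f. inj_on f (pverts G) \<and> pverts H = f ` pverts G \<and> parcs H = map_prod f f ` parcs G)"
    (is "?L \<longleftrightarrow> ?R")
proof
  interpret pair_wf_digraph G by fact
  {
    assume ?L
    then obtain h where h: "digraph_isomorphism h" "with_proj H = app_iso h (with_proj G)"
      by (auto simp: digraph_iso_def)
    then have H: "pverts H = iso_verts h ` pverts G" "parcs H = iso_arcs h ` parcs G"
        "iso_tail h = fst" "iso_head h = snd"
      by (simp_all add: with_proj_def app_iso_def)
    then have "iso_arcs h a = map_prod (iso_verts h) (iso_verts h) a" if "a \<in> parcs G" for a
      using h(1) that by (cases "iso_arcs h a"; cases a) (auto simp: digraph_isomorphism_def)
    then show ?R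
      using H h(1) by (intro exI [of _ "iso_verts h"]) (auto simp: digraph_isomorphism_def)
  next
    assume ?R
    then obtain f where f: "inj_on f (pverts G)" "pverts H = f ` pverts G"
        "parcs H = map_prod f f ` parcs G" by blast
    let ?h = "\<lparr>iso_verts = f, iso_arcs = map_prod f f, iso_head = snd, iso_tail = fst\<rparr>"
    have "inj_on (map_prod f f) (parcs G)"
      by (rule inj_on_subset [OF map_prod_inj_on [OF f(1) f(1)]]) (auto dest: in_arcsD1 in_arcsD2)
    then have "digraph_isomorphism ?h"
      using f wf_digraph by (auto simp: digraph_isomorphism_def)
    moreover have "with_proj H = app_iso ?h (with_proj G)"
      using f by (simp add: with_proj_def app_iso_def)
    ultimately show ?L by (auto simp: digraph_iso_def)
  }
qed

lemma map_prod_image_cong: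
  assumes "\<And>a b. (a, b) \<in> A \<Longrightarrow> f a = g a \<and> f b = g b"
  shows "map_prod f f ` A = map_prod g g ` A"
proof (rule image_cong [OF refl])
  fix e assume "e \<in> A"
  moreover obtain a b where "e = (a, b)" by (cases e)
  ultimately show "map_prod f f e = map_prod g g e" using assms [of a b] by simp
qed

text \<open>A numbering of \<open>H\<close> pulls back along an isomorphism. Conversely, two
  numberings with the same parameters compose to an isomorphism, namely \<open>y\<close> after the
  inverse of \<open>x\<close>.\<close>

lemma digraph_iso_chord_form:
  assumes G: "pair_wf_digraph G" and H: "has_chord_form H k i j y"
  shows "digraph_iso (with_proj G) (with_proj H) \<longleftrightarrow> (\<exists>x. has_chord_form G k i j x)"
proof
  interpret pair_wf_digraph G by fact
  assume iso: "digraph_iso (with_proj G) (with_proj H)"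
  obtain f where f: "inj_on f (pverts G)" "pverts H = f ` pverts G"
      "parcs H = map_prod f f ` parcs G"
    using digraph_iso_with_proj [OF G, THEN iffD1, OF iso] by (elim exE conjE)
  define g where "g = inv_into (pverts G) f"
  have g: "g (f v) = v" if "v \<in> pverts G" for v
    using f(1) that by (simp add: g_def)
  note H' = H [unfolded has_chord_form_def]
  have "inj_on g (pverts H)"
    unfolding g_def f(2) by (rule inj_on_inv_into) simp
  then have "inj_on (g \<circ> y) {..k}"
    using H' by (simp add: comp_inj_on)
  moreover have "pverts G = (g \<circ> y) ` {..k}"
  proof -
    have "pverts G = g ` f ` pverts G" using g by (simp add: image_image)
    also have "\<dots> = g ` y ` {..k}" using H' f(2) by simp
    finally show ?thesis by (simp add: image_comp)
  qed
  moreover have "parcs G = map_prod (g \<circ> y) (g \<circ> y) ` chord_arcs k i j"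
  proof -
    have "map_prod (g \<circ> f) (g \<circ> f) ` parcs G = map_prod id id ` parcs G"
      by (rule map_prod_image_cong) (simp add: g in_arcsD1 in_arcsD2)
    then have "parcs G = map_prod g g ` parcs H"
      unfolding f(3) by (simp add: image_comp map_prod.comp map_prod.id)
    also have "\<dots> = map_prod g g ` map_prod y y ` chord_arcs k i j" using H' by simp
    finally show ?thesis by (simp add: image_comp map_prod.comp)
  qed
  ultimately show "\<exists>x. has_chord_form G k i j x" unfolding has_chord_form_def by blast
next
  assume "\<exists>x. has_chord_form G k i j x"
  then obtain x where x: "has_chord_form G k i j x" by blast
  note x' = x [unfolded has_chord_form_def] and H' = H [unfolded has_chord_form_def]
  define f where "f = y \<circ> inv_into {..k} x"
  have f: "f (x t) = y t" if "t \<le> k" for t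
    using x' that by (simp add: f_def)
  have fx: "(f \<circ> x) ` {..k} = y ` {..k}" using f by (intro image_cong) simp_all
  have "inj_on f (x ` {..k})"
    by (rule inj_onI) (use f H' in \<open>auto dest: inj_onD\<close>)
  then have "inj_on f (pverts G)" using x' by simp
  moreover have "pverts H = f ` pverts G"
    using x' H' fx by (simp add: image_comp)
  moreover have "map_prod (f \<circ> x) (f \<circ> x) ` chord_arcs k i j = map_prod y y ` chord_arcs k i j"
    by (rule map_prod_image_cong) (simp add: f chord_arcs_def)
  then have "parcs H = map_prod f f ` parcs G"
    using x' H' by (simp add: image_comp map_prod.comp)
  ultimately show "digraph_iso (with_proj G) (with_proj H)"
    unfolding digraph_iso_with_proj [OF G] by (intro exI [of _ f] conjI)
qed

section \<open>Chord forms of the infinity and theta graphs\<close>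

lemma chord_arcs_subsetI:
  assumes "sym M" "\<And>t. t < k \<Longrightarrow> (t, Suc t) \<in> M" "(0, i) \<in> M" "(j, k) \<in> M"
  shows "chord_arcs k i j \<subseteq> M"
  using assms(2-) symD [OF assms(1)] by (auto simp: chord_arcs_def)

text \<open>Here \<open>g\<close> sends a vertex of the disjoint union to its path position, merging
  exactly the vertices that \<open>f\<close> identifies. Factoring \<open>f\<close> as
  \<open>y\<close> after \<open>g\<close> reduces the quotient to a computation with
  numbers.\<close>

lemma has_chord_form_identify:
  assumes inj: "inj_on y {..k}"
    and fy: "\<And>v. v \<in> pverts D \<Longrightarrow> f v = y (g v)"
    and D: "parcs D \<subseteq> pverts D \<times> pverts D"
    and g: "g ` pverts D = {..k}" "map_prod g g ` parcs D = chord_arcs k i j"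
  shows "has_chord_form (identify f D) k i j y"
proof -
  have "f ` pverts D = y ` g ` pverts D" using fy by force
  moreover have "map_prod f f ` parcs D = map_prod y y ` map_prod g g ` parcs D"
    unfolding image_image using D fy by (intro image_cong) auto
  ultimately show ?thesis
    using inj g by (simp add: has_chord_form_def identify_def)
qed

lemma parcs_cycle_graph:
  assumes "1 \<le> i"
  shows "(a, b) \<in> parcs (cycle_graph (Suc i)) \<longleftrightarrow> a \<le> i \<and> b \<le> i \<and>
    (b = Suc a \<or> a = Suc b \<or> a = i \<and> b = 0 \<or> a = 0 \<and> b = i)"
  using assms by (auto simp: cycle_graph_def mod_Suc)

text \<open>The Hamiltonian path starts at vertex 1 of the first cycle, goes round to its glued
  vertex 0 at position \<open>i\<close>, follows the connecting path to position
  \<open>i + m\<close>, and then runs round the second cycle. The two chords close the cycles. The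
  map \<open>y\<close> lists this path and \<open>g\<close> gives the positions.\<close>

lemma infinity_chord_form:
  assumes "2 \<le> i" "2 \<le> r"
  shows "\<exists>y. has_chord_form (infinity_graph (Suc i) (Suc m) (Suc r)) (i + m + r) i (i + m) y"
proof -
  define y :: "nat \<Rightarrow> nat \<times> nat" where
    "y t = (if t < i then (0, Suc t) else if t \<le> i + m then (1, t - i) else (2, t - (i + m)))" for t
  define g :: "nat \<times> nat \<Rightarrow> nat" where
    "g v = (if fst v = 0 then if snd v = 0 then i else snd v - 1
            else if fst v = 1 then i + snd v else i + m + snd v)" for v
  let ?D = "disjoint_union3 (cycle_graph (Suc i)) (path_graph (Suc m)) (cycle_graph (Suc r))"
  have arcs: "parcs ?D = {((c, a), (c, b)) | c a b.
      c = 0 \<and> (a, b) \<in> parcs (cycle_graph (Suc i)) \<or>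
      c = 1 \<and> (a, b) \<in> parcs (path_graph (Suc m)) \<or> c = 2 \<and> (a, b) \<in> parcs (cycle_graph (Suc r))}"
    by (auto simp: disjoint_union3_def)
  have verts: "pverts ?D = {0} \<times> {..i} \<union> {1} \<times> {..m} \<union> {2} \<times> {..r}"
    by (auto simp: disjoint_union3_def cycle_graph_def path_graph_def)
  have g: "g (0, 0) = i" "g (0, Suc a) = a" "g (Suc 0, a) = i + a" "g (1, a) = i + a" "g (2, a) = i + m + a" for a
    by (simp_all add: g_def)
  have chord0: "(g (0, a), g (0, b)) \<in> chord_arcs (i + m + r) i (i + m)"
    if "(a, b) \<in> parcs (cycle_graph (Suc i))" for a b
  proof -
    have "a \<le> i \<and> b \<le> i \<and> (b = Suc a \<or> a = Suc b \<or> a = i \<and> b = 0 \<or> a = 0 \<and> b = i)"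
      using that assms parcs_cycle_graph [of i a b] by simp
    then show ?thesis
      using assms by (cases a; cases b; simp add: g chord_arcs_def; linarith?)
  qed
  have chord2: "(g (2, a), g (2, b)) \<in> chord_arcs (i + m + r) i (i + m)"
    if "(a, b) \<in> parcs (cycle_graph (Suc r))" for a b
    using that assms by (auto simp: parcs_cycle_graph g chord_arcs_def)
  have chord1: "(g (1, a), g (1, b)) \<in> chord_arcs (i + m + r) i (i + m)"
    if "(a, b) \<in> parcs (path_graph (Suc m))" for a b
    using that assms by (auto simp: path_graph_def g chord_arcs_def)
  have chord: "(g u, g v) \<in> chord_arcs (i + m + r) i (i + m)" if "(u, v) \<in> parcs ?D" for u v
    using that chord0 chord1 chord2 unfolding arcs by blast
  have symD: "(v, u) \<in> parcs ?D" if "(u, v) \<in> parcs ?D" for u v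
  proof -
    have "(b, a) \<in> parcs (cycle_graph n)" if "(a, b) \<in> parcs (cycle_graph n)" for a b n
      using that by (auto simp: cycle_graph_def)
    moreover have "(b, a) \<in> parcs (path_graph n)" if "(a, b) \<in> parcs (path_graph n)" for a b n
      using that by (auto simp: path_graph_def)
    ultimately show ?thesis using that unfolding arcs by blast
  qed
  have step: "\<exists>u v. (u, v) \<in> parcs ?D \<and> g u = t \<and> g v = Suc t" if t: "t < i + m + r" for t
  proof -
    consider "Suc t < i" | "Suc t = i" | "i \<le> t" "t < i + m" | "i + m \<le> t" using t by linarith
    then show ?thesis
    proof cases
      case 1
      then show ?thesis unfolding arcs using assms
        by (intro exI [of _ "(0, Suc t)"] exI [of _ "(0, Suc (Suc t))"])
          (auto simp: parcs_cycle_graph g_def)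
    next
      case 2
      then show ?thesis unfolding arcs using assms
        by (intro exI [of _ "(0, Suc t)"] exI [of _ "(0, 0)"]) (auto simp: parcs_cycle_graph g_def)
    next
      case 3
      then show ?thesis unfolding arcs using assms
        by (intro exI [of _ "(1, t - i)"] exI [of _ "(1, Suc (t - i))"])
          (auto simp: path_graph_def g_def)
    next
      case 4
      then show ?thesis unfolding arcs using assms t
        by (intro exI [of _ "(2, t - (i + m))"] exI [of _ "(2, Suc (t - (i + m)))"])
          (auto simp: parcs_cycle_graph g_def)
    qed
  qed
  have c1: "\<exists>u v. (u, v) \<in> parcs ?D \<and> g u = 0 \<and> g v = i"
    unfolding arcs using assms
    by (intro exI [of _ "(0, 1)"] exI [of _ "(0, 0)"]) (auto simp: parcs_cycle_graph g_def)
  have c2: "\<exists>u v. (u, v) \<in> parcs ?D \<and> g u = i + m \<and> g v = i + m + r"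
    unfolding arcs using assms
    by (intro exI [of _ "(2, 0)"] exI [of _ "(2, r)"]) (auto simp: parcs_cycle_graph g_def)
  have gD: "map_prod g g ` parcs ?D = chord_arcs (i + m + r) i (i + m)"
  proof
    show "map_prod g g ` parcs ?D \<subseteq> chord_arcs (i + m + r) i (i + m)"
      using chord by auto
    have "sym (parcs ?D)" using symD by (auto intro: symI)
    then have "sym (map_prod g g ` parcs ?D)" by (auto simp: sym_def)
    then show "chord_arcs (i + m + r) i (i + m) \<subseteq> map_prod g g ` parcs ?D"
      by (rule chord_arcs_subsetI) (metis map_prod_imageI step c1 c2)+
  qed
  have "has_chord_form (identify (\<lambda>x. if x = (0, 0) then (1, 0) else if x = (2, 0) then (1, Suc m - 1) else x) ?D)
      (i + m + r) i (i + m) y"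
  proof (rule has_chord_form_identify [where g = g])
    show "inj_on y {..i + m + r}" by (auto simp: inj_on_def y_def split: if_splits)
    show "parcs ?D \<subseteq> pverts ?D \<times> pverts ?D"
      using assms unfolding arcs verts by (auto simp: parcs_cycle_graph path_graph_def)
    show "(if v = (0, 0) then (1, 0) else if v = (2, 0) then (1, Suc m - 1) else v) = y (g v)"
      if "v \<in> pverts ?D" for v
      using that assms unfolding verts by (auto simp: y_def g_def)
    have "t \<in> g ` pverts ?D" if "t \<le> i + m + r" for t
    proof -
      have "t = g (y t)" "y t \<in> pverts ?D" 
        using that unfolding verts by (auto simp: y_def g_def)
      then show ?thesis by (rule image_eqI)
    qed
    then show "g ` pverts ?D = {..i + m + r}"
      unfolding verts by (auto simp: g_def)
  qed (rule gD)
  then show ?thesis unfolding infinity_graph_def by blast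
qed

text \<open>The Hamiltonian path runs backwards along copy 1 from just before its terminal vertex to
  the common initial vertex at position \<open>l\<close>, forwards along copy 0 to the common
  terminal vertex at position \<open>l + p + 1\<close>, and backwards along copy 2. The chords are
  the edge of copy 1 at the terminal vertex and the edge of copy 2 at the initial vertex.\<close>

lemma theta_chord_form:
  "\<exists>y. has_chord_form (theta_graph p l q) (l + p + q + 1) (l + p + 1) l y"
proof -
  let ?k = "l + p + q + 1"
  define y :: "nat \<Rightarrow> nat \<times> nat" where
    "y t = (if t < l then (1, l - t) else if t \<le> l + p + 1 then (0, t - l) else (2, ?k + 1 - t))" for t
  define g :: "nat \<times> nat \<Rightarrow> nat" where
    "g v = (if fst v = 0 then l + snd v
            else if fst v = 1 then if snd v = l + 1 then l + p + 1 else l - snd v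
            else if snd v = 0 then l else ?k + 1 - snd v)" for v
  let ?D = "disjoint_union3 (path_graph (p + 2)) (path_graph (l + 2)) (path_graph (q + 2))"
  have arcs: "parcs ?D = {((c, a), (c, b)) | c a b.
      c = 0 \<and> (a, b) \<in> parcs (path_graph (p + 2)) \<or>
      c = 1 \<and> (a, b) \<in> parcs (path_graph (l + 2)) \<or> c = 2 \<and> (a, b) \<in> parcs (path_graph (q + 2))}"
    by (auto simp: disjoint_union3_def)
  have verts: "pverts ?D = {0} \<times> {..<p + 2} \<union> {1} \<times> {..<l + 2} \<union> {2} \<times> {..<q + 2}"
    by (auto simp: disjoint_union3_def path_graph_def)
  have chord0: "(g (0, a), g (0, b)) \<in> chord_arcs ?k (l + p + 1) l"
    if "(a, b) \<in> parcs (path_graph (p + 2))" for a b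
    using that by (auto simp: path_graph_def g_def chord_arcs_def)
  have chord1: "(g (1, a), g (1, b)) \<in> chord_arcs ?k (l + p + 1) l"
    if "(a, b) \<in> parcs (path_graph (l + 2))" for a b
  proof -
    have "b = Suc a \<and> a \<le> l \<or> a = Suc b \<and> b \<le> l" using that by (auto simp: path_graph_def)
    then show ?thesis
      by (elim disjE conjE; cases "a = l"; cases "b = l"; auto simp add: g_def chord_arcs_def)
  qed
  have chord2: "(g (2, a), g (2, b)) \<in> chord_arcs ?k (l + p + 1) l"
    if "(a, b) \<in> parcs (path_graph (q + 2))" for a b
  proof -
    have "b = Suc a \<and> a \<le> q \<or> a = Suc b \<and> b \<le> q" using that by (auto simp: path_graph_def)
    then show ?thesis
      by (elim disjE conjE; cases "a = 0"; cases "b = 0"; auto simp add: g_def chord_arcs_def)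
  qed
  have chord: "(g u, g v) \<in> chord_arcs ?k (l + p + 1) l" if "(u, v) \<in> parcs ?D" for u v
    using that chord0 chord1 chord2 unfolding arcs by blast
  have symD: "(v, u) \<in> parcs ?D" if "(u, v) \<in> parcs ?D" for u v
  proof -
    have "(b, a) \<in> parcs (path_graph n)" if "(a, b) \<in> parcs (path_graph n)" for a b n
      using that by (auto simp: path_graph_def)
    then show ?thesis using that unfolding arcs by blast
  qed
  have step: "\<exists>u v. (u, v) \<in> parcs ?D \<and> g u = t \<and> g v = Suc t" if t: "t < ?k" for t
  proof -
    consider "t < l" | "l \<le> t" "t < l + p + 1" | "l + p + 1 \<le> t" using t by linarith
    then show ?thesis
    proof cases
      case 1
      then show ?thesis unfolding arcs
        by (intro exI [of _ "(1, l - t)"] exI [of _ "(1, l - Suc t)"])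
          (auto simp: path_graph_def g_def)
    next
      case 2
      then show ?thesis unfolding arcs
        by (intro exI [of _ "(0, t - l)"] exI [of _ "(0, Suc (t - l))"])
          (auto simp: path_graph_def g_def)
    next
      case 3
      then show ?thesis unfolding arcs using t
        by (intro exI [of _ "(2, ?k + 1 - t)"] exI [of _ "(2, ?k - t)"])
          (auto simp: path_graph_def g_def)
    qed
  qed
  have c1: "\<exists>u v. (u, v) \<in> parcs ?D \<and> g u = 0 \<and> g v = l + p + 1"
    unfolding arcs
    by (intro exI [of _ "(1, l)"] exI [of _ "(1, l + 1)"]) (auto simp: path_graph_def g_def)
  have c2: "\<exists>u v. (u, v) \<in> parcs ?D \<and> g u = l \<and> g v = ?k"
    unfolding arcs
    by (intro exI [of _ "(2, 0)"] exI [of _ "(2, 1)"]) (auto simp: path_graph_def g_def)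
  have gD: "map_prod g g ` parcs ?D = chord_arcs ?k (l + p + 1) l"
  proof
    show "map_prod g g ` parcs ?D \<subseteq> chord_arcs ?k (l + p + 1) l"
      using chord by auto
    have "sym (parcs ?D)" using symD by (auto intro: symI)
    then have "sym (map_prod g g ` parcs ?D)" by (auto simp: sym_def)
    then show "chord_arcs ?k (l + p + 1) l \<subseteq> map_prod g g ` parcs ?D"
      by (rule chord_arcs_subsetI) (metis map_prod_imageI step c1 c2)+
  qed
  have "has_chord_form (identify (\<lambda>x. if x \<in> {(0, 0), (1, 0), (2, 0)} then (0, 0)
      else if x \<in> {(0, p + 1), (1, l + 1), (2, q + 1)} then (0, p + 1) else x) ?D) ?k (l + p + 1) l y"
  proof (rule has_chord_form_identify [where g = g])
    show "inj_on y {..?k}" by (auto simp: inj_on_def y_def split: if_splits)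
    show "parcs ?D \<subseteq> pverts ?D \<times> pverts ?D"
      unfolding arcs verts by (auto simp: path_graph_def)
    show "(if v \<in> {(0, 0), (1, 0), (2, 0)} then (0, 0)
        else if v \<in> {(0, p + 1), (1, l + 1), (2, q + 1)} then (0, p + 1) else v) = y (g v)"
      if vD: "v \<in> pverts ?D" for v
    proof -
      obtain c a where v: "v = (c, a)" by (cases v)
      consider "c = 0" "a < p + 2" | "c = 1" "a < l + 2" | "c = 2" "a < q + 2"
        using vD v unfolding verts by auto
      then show ?thesis
      proof cases
        case 1
        then show ?thesis unfolding v by (cases "a = 0"; cases "a = p + 1"; simp add: y_def g_def)
      next
        case 2
        then show ?thesis unfolding v
          by (cases "a = 0"; cases "a = l + 1"; simp add: y_def g_def; linarith?)
      next
        case 3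
        then show ?thesis unfolding v
          by (cases "a = 0"; cases "a = q + 1"; simp add: y_def g_def; linarith?)
      qed
    qed
    have "t \<in> g ` pverts ?D" if "t \<le> ?k" for t
    proof -
      have "t = g (y t)" "y t \<in> pverts ?D" 
        using that unfolding verts by (auto simp: y_def g_def)
      then show ?thesis by (rule image_eqI)
    qed
    then show "g ` pverts ?D = {..?k}"
      unfolding verts by (auto simp: g_def)
  qed (rule gD)
  then show ?thesis unfolding theta_graph_def by blast
qed

section \<open>Left kernels and Type 1 cycles\<close>

definition left_kernel :: "'v set \<Rightarrow> ('v \<Rightarrow> 'v \<Rightarrow> quat) \<Rightarrow> ('v \<Rightarrow> quat) \<Rightarrow> bool" where
  "left_kernel V A c \<longleftrightarrow> (\<forall>v\<in>V. (\<Sum>u\<in>V. c u * A u v) = 0)"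

lemma left_kernel_add_mult:
  assumes "left_kernel V A c" "left_kernel V A d"
  shows "left_kernel V A (\<lambda>v. c v + q * d v)"
  using assms by (simp add: left_kernel_def distrib_right sum.distrib mult.assoc sum_distrib_left [symmetric])

text \<open>Extending coefficients on \<open>S\<close> by zero turns a row dependency into a kernel
  vector vanishing off \<open>S\<close>. Rank bounds thus become questions about kernel vectors with
  prescribed zeros.\<close>

lemma left_indep_rows_iff:
  assumes "finite V" "S \<subseteq> V"
  shows "left_indep_rows V A S \<longleftrightarrow>
    (\<forall>c. left_kernel V A c \<and> (\<forall>v\<in>V - S. c v = 0) \<longrightarrow> (\<forall>v\<in>V. c v = 0))"
proof -
  have eq: "(\<Sum>u\<in>V. c u * A u v) = (\<Sum>u\<in>S. c u * A u v)" if "\<forall>v\<in>V - S. c v = 0" for c v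
    by (rule sum.mono_neutral_right) (use assms that in auto)
  show ?thesis
  proof (intro iffI allI impI)
    fix c assume "left_indep_rows V A S" and "left_kernel V A c \<and> (\<forall>v\<in>V - S. c v = 0)"
    then show "\<forall>v\<in>V. c v = 0"
      using eq [of c] by (auto simp: left_indep_rows_def left_kernel_def)
  next
    assume R: "\<forall>c. left_kernel V A c \<and> (\<forall>v\<in>V - S. c v = 0) \<longrightarrow> (\<forall>v\<in>V. c v = 0)"
    show "left_indep_rows V A S"
      unfolding left_indep_rows_def
    proof (intro allI impI)
      fix c assume c: "\<forall>v\<in>V. (\<Sum>u\<in>S. c u * A u v) = 0"
      let ?c = "\<lambda>v. if v \<in> S then c v else 0"
      have "left_kernel V A ?c" using c eq [of ?c] by (simp add: left_kernel_def)
      moreover have "\<forall>v\<in>V - S. ?c v = 0" by simp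
      ultimately have "\<forall>v\<in>V. ?c v = 0" using R by blast
      then show "\<forall>v\<in>S. c v = 0" using assms(2) by (metis subsetD)
    qed
  qed
qed

lemma row_left_rank_le_iff:
  assumes "finite V"
  shows "row_left_rank V A \<le> m \<longleftrightarrow> (\<forall>S\<subseteq>V. left_indep_rows V A S \<longrightarrow> card S \<le> m)"
proof -
  let ?R = "{card S | S. S \<subseteq> V \<and> left_indep_rows V A S}"
  have "finite ?R" using assms by simp
  moreover have "left_indep_rows V A {}" by (simp add: left_indep_rows_def)
  then have "?R \<noteq> {}" by blast
  ultimately have "Max ?R \<le> m \<longleftrightarrow> (\<forall>a\<in>?R. a \<le> m)" by (rule Max_le_iff)
  then show ?thesis unfolding row_left_rank_def by auto
qed

context quat_gain_graph
begin

lemma gain_nonzero: "(u, v) \<in> parcs G \<Longrightarrow> \<phi> (u, v) \<noteq> 0"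
  using gain_unit by fastforce

lemma gain_mult_reverse: "(u, v) \<in> parcs G \<Longrightarrow> \<phi> (u, v) * \<phi> (v, u) = 1"
  using gain_inverse gain_nonzero arcs_symmetric by (metis left_inverse)

lemma gain_mult_eq_iff: "(u, v) \<in> parcs G \<Longrightarrow> a * \<phi> (u, v) = b \<longleftrightarrow> a = b * \<phi> (v, u)"
  using gain_mult_reverse [of u v] gain_mult_reverse [of v u] arcs_symmetric [of u v]
  by (auto simp: mult.assoc)

text \<open>The hypotheses hold when \<open>d\<close> is a left kernel vector supported on \<open>Y\<close> and all vertices outside
  \<open>Y\<close> have degree two. Every second vertex of a cycle then contributes a factor \<open>-1\<close>, and the values
  of \<open>d\<close> telescope.\<close>

lemma type1_if_telescoping:
  assumes bip: "\<And>u v. (u, v) \<in> parcs G \<Longrightarrow> u \<in> Y \<longleftrightarrow> v \<notin> Y"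
    and d: "\<And>u. u \<in> Y \<Longrightarrow> d u \<noteq> 0"
    and tele: "\<And>y w y'. \<lbrakk>(y, w) \<in> parcs G; (w, y') \<in> parcs G; y \<in> Y; y \<noteq> y'\<rbrakk> \<Longrightarrow>
      \<phi> (y, w) * \<phi> (w, y') = - (inverse (d y) * d y')"
    and C: "graph_cycle G C"
  shows "type1 \<phi> C"
proof -
  define m where "m = length C"
  have m: "3 \<le> m" using C by (simp add: graph_cycle_def m_def)
  obtain u where u: "awalk u C u" "distinct (tl (pawalk_verts u C))"
    using C by (auto simp: graph_cycle_def cycle_def)
  have ne: "C \<noteq> []" using m m_def by auto
  have arcs: "set C \<subseteq> parcs G" and cas: "pcas u C u" using u by (auto simp: awalk_def)
  have consec: "snd (C ! t) = fst (C ! Suc t)" if "Suc t < length C" "pcas a C b" for a b t and C :: "('a \<times> 'a) list"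
    using that
  proof (induction C arbitrary: a t)
    case (Cons e C)
    then show ?case by (cases t; cases C) auto
  qed simp
  have ends: "fst (C ! 0) = u" "snd (C ! (m - 1)) = u"
  proof -
    show "fst (C ! 0) = u" using cas ne by (cases C) auto
    have "pcas a C b \<Longrightarrow> C \<noteq> [] \<Longrightarrow> snd (last C) = b" for a b and C :: "('a \<times> 'a) list"
      by (induction C arbitrary: a) auto
    then show "snd (C ! (m - 1)) = u" using cas ne by (metis last_conv_nth m_def)
  qed
  define v where "v t = fst (C ! (t mod m))" for t
  have Cv: "C ! t = (v t, v (Suc t))" if "t < m" for t
  proof (cases "Suc t < m")
    case True
    then show ?thesis using consec [OF _ cas, of t] by (simp add: v_def m_def prod_eq_iff)
  next
    case False
    then have "t = m - 1" "Suc t = m" using that by linarith+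
    then show ?thesis using ends by (simp add: v_def prod_eq_iff)
  qed
  have vper: "v (t + m) = v t" for t by (simp add: v_def)
  have vmod: "v (t mod m) = v t" "v (Suc (t mod m)) = v (Suc t)" for t
    by (simp_all add: v_def mod_Suc_eq)
  have adj: "(v t, v (Suc t)) \<in> parcs G" for t
  proof -
    have "t mod m < m" using m by simp
    then have "C ! (t mod m) \<in> parcs G" using arcs m_def by auto
    then show ?thesis using Cv [OF \<open>t mod m < m\<close>] vmod by simp
  qed
  have dist: "distinct (map fst C)"
  proof -
    have "pawalk_verts u C = map fst C @ [u]"
    proof -
      have "pcas a C b \<Longrightarrow> pawalk_verts a C = map fst C @ [b]" for a b and C :: "('a \<times> 'a) list"
        by (induction C arbitrary: a) auto
      then show ?thesis using cas .
    qed
    moreover obtain e C' where "C = e # C'" using ne by (cases C) auto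
    moreover then have "fst e = u" using cas by simp
    ultimately show ?thesis using u(2) by auto
  qed
  have inj: "a mod m = b mod m" if "v a = v b" for a b
  proof -
    have "a mod m < length (map fst C)" "b mod m < length (map fst C)"
      using ne by (simp_all add: m_def)
    then show ?thesis using that nth_eq_iff_index_eq [OF dist] by (simp add: v_def)
  qed
  \<comment> \<open>A cycle of length at least three never returns along the edge just used;
    \<open>tele\<close> applies only to such steps.\<close>
  have skip: "v t \<noteq> v (Suc (Suc t))" for t
  proof
    assume "v t = v (Suc (Suc t))"
    then have "t mod m = Suc (Suc t) mod m" by (rule inj)
    moreover have "Suc (Suc t) mod m \<noteq> t mod m" using m by (auto simp: mod_Suc)
    ultimately show False by simp
  qed
  \<comment> \<open>Every arc crosses between \<open>Y\<close> and its complement, so membership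
    alternates; once round the cycle, this makes \<open>m\<close> even.\<close>
  have parity: "v t \<in> Y \<longleftrightarrow> (v 0 \<in> Y \<longleftrightarrow> even t)" for t
  proof (induction t)
    case (Suc t)
    then show ?case using bip [OF adj [of t]] by auto
  qed simp
  have even_m: "even m" using parity [of m] vper [of 0] by auto
  define P where "P a b = prod_list (map (\<lambda>t. \<phi> (v t, v (Suc t))) [a..<b])" for a b
  have P_Suc: "P a (Suc b) = P a b * \<phi> (v b, v (Suc b))" if "a \<le> b" for a b
    using that by (simp add: P_def)
  have "map \<phi> C = map (\<lambda>t. \<phi> (v t, v (Suc t))) [0..<m]"
    using Cv by (intro nth_equalityI) (simp_all add: m_def)
  then have PC: "prod_list (map \<phi> C) = P 0 m" by (simp add: P_def)
  have tele_P: "P a (a + 2 * r) = (- 1) ^ r * (inverse (d (v a)) * d (v (a + 2 * r)))" if a: "v a \<in> Y" for a r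
  proof (induction r)
    case 0
    then show ?case using d [OF a] by (simp add: P_def)
  next
    case (Suc r)
    let ?b = "a + 2 * r"
    have b: "v ?b \<in> Y" using a parity [of a] parity [of ?b] by simp
    have "P a (a + 2 * Suc r) = P a ?b * (\<phi> (v ?b, v (Suc ?b)) * \<phi> (v (Suc ?b), v (Suc (Suc ?b))))"
      by (simp add: P_Suc mult.assoc)
    also have "\<dots> = P a ?b * (- (inverse (d (v ?b)) * d (v (Suc (Suc ?b)))))"
      using tele [OF adj adj b skip] by simp
    also have "\<dots> = - ((- 1) ^ r * (inverse (d (v a)) * ((d (v ?b) * inverse (d (v ?b))) * d (v (Suc (Suc ?b))))))"
      unfolding Suc.IH by (simp add: mult.assoc)
    also have "d (v ?b) * inverse (d (v ?b)) = 1" using d [OF b] by simp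
    finally show ?case by simp
  qed
  have closed: "P a (a + m) = (- 1) ^ (m div 2)" if "v a \<in> Y" for a
    using tele_P [OF that, of "m div 2"] even_m vper [of a] d [OF that] by simp
  have "P 0 m = (- 1) ^ (m div 2)"
  proof (cases "v 0 \<in> Y")
    case True
    then show ?thesis using closed [of 0] by simp
  next
    case False
    \<comment> \<open>The product started outside \<open>Y\<close> is conjugate, by the first gain,
      to the one started at \<open>v 1\<close>, and the sign \<open>?e\<close> is central.\<close>
    let ?f = "\<phi> (v 0, v 1)" and ?e = "(- 1) ^ (m div 2) :: quat"
    have "[0..<m] = 0 # [1..<m]" using m by (simp add: upt_conv_Cons)
    then have "P 0 m = ?f * P 1 m" by (simp add: P_def)
    moreover have "P 1 (1 + m) = P 1 m * ?f"
      using P_Suc [of 1 m] vper [of 0] vper [of 1] m by simp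
    moreover have "P 1 (1 + m) = ?e"
      using closed [of 1] parity [of 1] False by simp
    ultimately have "P 0 m * ?f = ?f * ?e" by (simp add: mult.assoc)
    also have "?f * ?e = ?e * ?f" by (cases "even (m div 2)") simp_all
    finally show ?thesis using gain_nonzero [OF adj [of 0]] by simp
  qed
  then show ?thesis using even_m PC by (simp add: type1_def m_def)
qed

end

section \<open>The left kernel in path positions and the case of rank n - 3\<close>

locale chord_gain_graph = quat_gain_graph G \<phi>
  for G :: "'v pair_pre_digraph" and \<phi> :: "'v \<times> 'v \<Rightarrow> quat" +
  fixes k i j :: nat and x :: "nat \<Rightarrow> 'v"
  assumes form: "has_chord_form G k i j x"
    and i_bounds: "2 \<le> i" "i \<le> k" and j_bounds: "j + 2 \<le> k"
begin

abbreviation "\<Gamma> \<equiv> chord_arcs k i j"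
abbreviation "kern \<equiv> left_kernel (pverts G) (adj_matrix G \<phi>)"

lemma inj_x: "inj_on x {..k}" and pverts_eq: "pverts G = x ` {..k}"
  using form by (simp_all add: has_chord_form_def)

lemma x_eq_iff: "\<lbrakk>s \<le> k; t \<le> k\<rbrakk> \<Longrightarrow> x s = x t \<longleftrightarrow> s = t"
  using inj_x by (auto dest: inj_onD)

lemma card_pverts: "card (pverts G) = k + 1"
  using card_image [OF inj_x] by (simp add: pverts_eq)

lemma arc_iff: "\<lbrakk>s \<le> k; t \<le> k\<rbrakk> \<Longrightarrow> (x s, x t) \<in> parcs G \<longleftrightarrow> (s, t) \<in> \<Gamma>"
  using form x_eq_iff by (auto simp: has_chord_form_def chord_arcs_def)

lemma chord_le: "(s, t) \<in> \<Gamma> \<Longrightarrow> s \<le> k \<and> t \<le> k"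
  by (simp add: chord_arcs_def)

lemma chord_sym: "(s, t) \<in> \<Gamma> \<Longrightarrow> (t, s) \<in> \<Gamma>"
  by (auto simp: chord_arcs_def)

lemma chord_arc: "(s, t) \<in> \<Gamma> \<Longrightarrow> (x s, x t) \<in> parcs G"
  using arc_iff chord_le by blast

lemma chord_Suc: "t < k \<Longrightarrow> (t, Suc t) \<in> \<Gamma>" "t < k \<Longrightarrow> (Suc t, t) \<in> \<Gamma>"
  and chord_i: "(0, i) \<in> \<Gamma>" "(i, 0) \<in> \<Gamma>" and chord_j: "(j, k) \<in> \<Gamma>" "(k, j) \<in> \<Gamma>"
  using i_bounds j_bounds by (auto simp: chord_arcs_def)

lemma kern_iff: "kern c \<longleftrightarrow> (\<forall>t\<le>k. (\<Sum>s | (s, t) \<in> \<Gamma>. c (x s) * \<phi> (x s, x t)) = 0)"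
proof -
  have "(\<Sum>u\<in>pverts G. c u * adj_matrix G \<phi> u (x t)) = (\<Sum>s | (s, t) \<in> \<Gamma>. c (x s) * \<phi> (x s, x t))"
    if t: "t \<le> k" for t
  proof -
    have "(\<Sum>u\<in>pverts G. c u * adj_matrix G \<phi> u (x t)) = (\<Sum>s\<le>k. c (x s) * adj_matrix G \<phi> (x s) (x t))"
      by (simp add: pverts_eq sum.reindex [OF inj_x])
    also have "\<dots> = (\<Sum>s\<le>k. if (s, t) \<in> \<Gamma> then c (x s) * \<phi> (x s, x t) else 0)"
      using t by (intro sum.cong) (auto simp: adj_matrix_def arc_iff)
    also have "\<dots> = (\<Sum>s | s \<le> k \<and> (s, t) \<in> \<Gamma>. c (x s) * \<phi> (x s, x t))"
      by (subst sum.inter_filter [symmetric]) auto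
    also have "{s. s \<le> k \<and> (s, t) \<in> \<Gamma>} = {s. (s, t) \<in> \<Gamma>}" using chord_le by auto
    finally show ?thesis .
  qed
  then show ?thesis by (auto simp: left_kernel_def pverts_eq)
qed

lemma finite_column: "finite {s. (s, t) \<in> \<Gamma>}"
  by (rule finite_subset [of _ "{..k}"]) (use chord_le in auto)

context
  fixes c assumes c: "kern c" "c (x 0) = 0" "c (x k) = 0"
begin

text \<open>In the equation at a path vertex, every neighbour besides two chosen ones sits at
  position \<open>0\<close> or \<open>k\<close>, where \<open>c\<close> vanishes. So each equation
  links only two values of \<open>c\<close>.\<close>

lemma kern_pair:
  assumes "t \<le> k" "a \<noteq> b" "(a, t) \<in> \<Gamma>" "(b, t) \<in> \<Gamma>" "\<And>s. (s, t) \<in> \<Gamma> \<Longrightarrow> s \<in> {a, b, 0, k}"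
  shows "c (x a) * \<phi> (x a, x t) + c (x b) * \<phi> (x b, x t) = 0"
proof -
  have "(\<Sum>s | (s, t) \<in> \<Gamma>. c (x s) * \<phi> (x s, x t)) = (\<Sum>s\<in>{a, b}. c (x s) * \<phi> (x s, x t))"
    by (rule sum.mono_neutral_right) (use assms c finite_column in auto)
  moreover have "(\<Sum>s | (s, t) \<in> \<Gamma>. c (x s) * \<phi> (x s, x t)) = 0"
    using c(1) assms(1) by (simp add: kern_iff)
  ultimately show ?thesis using assms(2) by simp
qed

lemma kern_interior:
  "Suc (Suc t) \<le> k \<Longrightarrow>
    c (x t) * \<phi> (x t, x (Suc t)) + c (x (Suc (Suc t))) * \<phi> (x (Suc (Suc t)), x (Suc t)) = 0"
  by (rule kern_pair) (auto simp: chord_arcs_def)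

lemma kern_start: "c (x 1) * \<phi> (x 1, x 0) + c (x i) * \<phi> (x i, x 0) = 0"
  using i_bounds j_bounds by (intro kern_pair) (auto simp: chord_arcs_def)

lemma kern_end: "c (x (k - 1)) * \<phi> (x (k - 1), x k) + c (x j) * \<phi> (x j, x k) = 0"
  using i_bounds j_bounds by (intro kern_pair) (auto simp: chord_arcs_def)

lemma kern_pair_zero_iff:
  assumes "c (x a) * \<phi> (x a, x t) + c (x b) * \<phi> (x b, x t) = 0" "(a, t) \<in> \<Gamma>" "(b, t) \<in> \<Gamma>"
  shows "c (x a) = 0 \<longleftrightarrow> c (x b) = 0"
  using assms gain_nonzero chord_arc by (metis add.left_neutral add.right_neutral mult_eq_0_iff mult_zero_left)

lemma kern_even: "2 * r \<le> k \<Longrightarrow> c (x (2 * r)) = 0"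
proof (induction r)
  case (Suc r)
  then show ?case
    using kern_pair_zero_iff [OF kern_interior [of "2 * r"]] chord_Suc [of "2 * r"] chord_Suc [of "Suc (2 * r)"]
    by simp
qed (use c in simp)

lemma kern_odd: "Suc (2 * r) \<le> k \<Longrightarrow> c (x (Suc (2 * r))) = 0 \<longleftrightarrow> c (x 1) = 0"
proof (induction r)
  case (Suc r)
  then show ?case
    using kern_pair_zero_iff [OF kern_interior [of "Suc (2 * r)"]]
      chord_Suc [of "Suc (2 * r)"] chord_Suc [of "Suc (Suc (2 * r))"]
    by simp
qed simp

text \<open>The interior equations link positions two apart: even ones inherit the zero at
  \<open>x 0\<close>, and odd ones vanish exactly when \<open>x 1\<close> does.\<close>

lemma kern_parity: "t \<le> k \<Longrightarrow> c (x t) = 0 \<longleftrightarrow> even t \<or> c (x 1) = 0"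
  using kern_even kern_odd by (cases "even t") (auto elim!: evenE oddE)

end

text \<open>A kernel vector vanishing at \<open>x 0\<close>, \<open>x 1\<close> and
  \<open>x k\<close> is zero, so the other \<open>k - 2\<close> rows are independent.\<close>

lemma rank_ge: "k \<le> gain_rank G \<phi> + 2"
proof -
  let ?S = "pverts G - x ` {0, 1, k}"
  have "left_indep_rows (pverts G) (adj_matrix G \<phi>) ?S"
  proof -
    have "c v = 0" if "kern c" "\<forall>v\<in>pverts G - ?S. c v = 0" "v \<in> pverts G" for c v
    proof -
      have "x 0 \<in> pverts G - ?S" "x 1 \<in> pverts G - ?S" "x k \<in> pverts G - ?S"
        using i_bounds by (auto simp: pverts_eq)
      then have "c (x 0) = 0" "c (x 1) = 0" "c (x k) = 0" using that(2) by blast+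
      then show ?thesis using kern_parity [OF that(1)] that(3) by (auto simp: pverts_eq)
    qed
    then show ?thesis by (subst left_indep_rows_iff) (use pair_finite_verts in auto)
  qed
  then have "card ?S \<le> gain_rank G \<phi>"
    using row_left_rank_le_iff [OF pair_finite_verts] unfolding gain_rank_def by blast
  moreover have "x ` {0, 1, k} \<subseteq> pverts G" using i_bounds by (auto simp: pverts_eq)
  moreover have "card (x ` {0, 1, k}) = 3"
    using i_bounds x_eq_iff by (subst card_image) (auto simp: inj_on_def)
  ultimately show ?thesis using card_pverts by (simp add: card_Diff_subset)
qed

text \<open>Without \<open>x 0\<close> and \<open>x k\<close> there are \<open>k - 1\<close> rows,
  one more than the rank, hence a dependency among them. It is nonzero, so by parity it cannot
  vanish at \<open>x 1\<close>.\<close>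

lemma kern_exists:
  assumes "gain_rank G \<phi> + 2 = k"
  obtains c where "kern c" "c (x 0) = 0" "c (x k) = 0" "c (x 1) \<noteq> 0"
proof -
  let ?S = "pverts G - x ` {0, k}"
  have sub: "x ` {0, k} \<subseteq> pverts G" by (auto simp: pverts_eq)
  have "card (x ` {0, k}) = 2"
    using i_bounds x_eq_iff by (subst card_image) (auto simp: inj_on_def)
  then have "card ?S = k - 1" using card_pverts sub by (simp add: card_Diff_subset)
  then have "\<not> card ?S \<le> gain_rank G \<phi>" using assms by simp
  then have "\<not> left_indep_rows (pverts G) (adj_matrix G \<phi>) ?S"
    using row_left_rank_le_iff [OF pair_finite_verts] unfolding gain_rank_def by blast
  then obtain c v where c: "kern c" "\<forall>v\<in>pverts G - ?S. c v = 0" "v \<in> pverts G" "c v \<noteq> 0"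
    by (subst (asm) left_indep_rows_iff) (use pair_finite_verts in auto)
  then have ends: "c (x 0) = 0" "c (x k) = 0" using sub by auto
  obtain t where "t \<le> k" "v = x t" using c(3) by (auto simp: pverts_eq)
  then have "c (x 1) \<noteq> 0" using kern_parity [OF c(1) ends] c(4) by metis
  then show thesis using that c(1) ends by blast
qed

text \<open>The vector \<open>c\<close> vanishes precisely at even positions. Its zero at
  \<open>x k\<close> gives the parity of \<open>k\<close>, and the equations at the two ends
  transfer nonvanishing from \<open>x 1\<close> to \<open>x i\<close> and from
  \<open>x (k - 1)\<close> to \<open>x j\<close>.\<close>

lemma parity_type1:
  assumes "gain_rank G \<phi> + 2 = k"
  shows "odd i" "odd j" "even k" "graph_cycle G C \<Longrightarrow> type1 \<phi> C"
proof -
  obtain c where c: "kern c" "c (x 0) = 0" "c (x k) = 0" and c1: "c (x 1) \<noteq> 0"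
    using kern_exists [OF assms] .
  note parity = kern_parity [OF c]
  show k: "even k" using parity [of k] c c1 by simp
  show i: "odd i"
    using kern_pair_zero_iff [OF c kern_start [OF c]] chord_Suc [of 0] chord_i parity [of i] c1 i_bounds by simp
  have "odd (k - 1)" using k i_bounds by simp
  then show j: "odd j"
    using kern_pair_zero_iff [OF c kern_end [OF c]] chord_Suc [of "k - 1"] chord_j
      parity [of "k - 1"] parity [of j] c1 i_bounds j_bounds by simp
  let ?Y = "x ` {t. t \<le> k \<and> odd t}"
  have Y: "x t \<in> ?Y \<longleftrightarrow> odd t" if "t \<le> k" for t
    using that x_eq_iff by auto
  have \<Gamma>: "even s \<longleftrightarrow> odd t" if "(s, t) \<in> \<Gamma>" for s t
    using that i j k by (auto simp: chord_arcs_def)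
  have arcE: "\<exists>s t. u = x s \<and> v = x t \<and> (s, t) \<in> \<Gamma>" if "(u, v) \<in> parcs G" for u v
    using that form by (auto simp: has_chord_form_def)
  have pair: "c (x s) * \<phi> (x s, x t) + c (x s') * \<phi> (x s', x t) = 0"
    if st: "(s, t) \<in> \<Gamma>" "(s', t) \<in> \<Gamma>" "s \<noteq> s'" "even t" for s s' t
  proof -
    \<comment> \<open>Only \<open>i\<close> and \<open>j\<close> can have degree above two and both
      are odd, so \<open>s\<close> and \<open>s'\<close> are all neighbours of the even position
      \<open>t\<close>.\<close>
    have "t \<noteq> i" "t \<noteq> j" using i j st by auto
    then have "q \<in> {s, s', 0, k}" if "(q, t) \<in> \<Gamma>" for q
      using st that by (auto simp: chord_arcs_def)
    then show ?thesis using st chord_le by (intro kern_pair [OF c]) blast+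
  qed
  show "type1 \<phi> C" if "graph_cycle G C"
  proof (rule type1_if_telescoping [of ?Y c, OF _ _ _ that])
    show "u \<in> ?Y \<longleftrightarrow> v \<notin> ?Y" if "(u, v) \<in> parcs G" for u v
      using arcE [OF that] Y \<Gamma> chord_le by metis
    show "c u \<noteq> 0" if "u \<in> ?Y" for u using that parity c1 by auto
    show "\<phi> (y, w) * \<phi> (w, y') = - (inverse (c y) * c y')"
      if arcs: "(y, w) \<in> parcs G" "(w, y') \<in> parcs G" and y: "y \<in> ?Y" "y \<noteq> y'" for y w y'
    proof -
      obtain s t where st: "y = x s" "w = x t" "(s, t) \<in> \<Gamma>" using arcE [OF arcs(1)] by blast
      obtain t' s' where ts: "w = x t'" "y' = x s'" "(t', s') \<in> \<Gamma>" using arcE [OF arcs(2)] by blast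
      have t': "t' = t" using st ts chord_le x_eq_iff by metis
      have "odd s" using Y y st chord_le by metis
      then have "even t" using \<Gamma> st by metis
      then have "c y * \<phi> (y, w) + c y' * \<phi> (y', w) = 0"
        using pair [of s t s'] st ts t' y chord_sym by auto
      then have eq: "c y * \<phi> (y, w) = - (c y' * \<phi> (y', w))" by (simp add: eq_neg_iff_add_eq_0)
      have cy: "c y \<noteq> 0" using \<open>odd s\<close> parity c1 st chord_le by metis
      have "c y * (\<phi> (y, w) * \<phi> (w, y')) = - (c y' * (\<phi> (y', w) * \<phi> (w, y')))"
        by (simp add: mult.assoc [symmetric] eq)
      also have "\<phi> (y', w) * \<phi> (w, y') = 1" using gain_mult_reverse arcs arcs_symmetric by blast
      finally have "inverse (c y) * (c y * (\<phi> (y, w) * \<phi> (w, y'))) = inverse (c y) * - c y'" by simp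
      then show ?thesis using cy by (simp add: mult.assoc [symmetric])
    qed
  qed
qed

end

section \<open>Kernel vectors of graphs with Type 1 cycles\<close>

context chord_gain_graph
begin

text \<open>Used for the segments from \<open>0\<close> to \<open>i\<close> and from
  \<open>j\<close> to \<open>k\<close>, each closed by its chord.\<close>

lemma graph_cycle_segment:
  assumes "a + 2 \<le> b" "b \<le> k" "(x b, x a) \<in> parcs G"
  shows "graph_cycle G (map (\<lambda>t. (x t, x (Suc t))) [a..<b] @ [(x b, x a)])" (is "graph_cycle G ?C")
proof -
  \<comment> \<open>The induction moves the start \<open>s\<close>, so the target \<open>z\<close>
    of the closing arc must be independent of it.\<close>
  have pc: "pcas (x s) (map (\<lambda>t. (x t, x (Suc t))) [s..<b] @ [(x b, z)]) z" if "s \<le> b" for s z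
    using that by (induction s rule: inc_induct) (simp_all add: upt_conv_Cons)
  have "pcas (x a) ?C (x a)" by (rule pc) (use assms in simp)
  moreover have "set ?C \<subseteq> parcs G" using assms chord_Suc chord_arc by auto
  ultimately have "awalk (x a) ?C (x a)"
    using assms by (simp add: awalk_def pverts_eq)
  moreover have "pawalk_verts (x a) ?C = map x [a..<Suc b] @ [x a]"
    using awalk_verts_conv [of "x a" ?C] assms(1) by simp
  then have "tl (pawalk_verts (x a) ?C) = map x ([Suc a..<Suc b] @ [a])"
    using assms(1) by (simp add: upt_conv_Cons)
  moreover have "inj_on x (set ([Suc a..<Suc b] @ [a]))"
    by (rule inj_on_subset [OF inj_x]) (use assms in auto)
  then have "distinct (map x ([Suc a..<Suc b] @ [a]))"
    unfolding distinct_map by simp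
  ultimately show ?thesis
    using assms(1) by (auto simp: graph_cycle_def cycle_def)
qed

text \<open>The gain of the path from \<open>x 0\<close> to \<open>x t\<close>. Used as a switching
  function, it makes all path gains equal to 1.\<close>

definition gain_prefix :: "nat \<Rightarrow> quat" where
  "gain_prefix t = prod_list (map (\<lambda>s. \<phi> (x s, x (Suc s))) [0..<t])"

lemma gain_prefix_0: "gain_prefix 0 = 1"
  and gain_prefix_Suc: "gain_prefix (Suc t) = gain_prefix t * \<phi> (x t, x (Suc t))"
  by (simp_all add: gain_prefix_def)

lemma gain_prefix_nonzero: "t \<le> k \<Longrightarrow> gain_prefix t \<noteq> 0"
  by (induction t) (use gain_nonzero chord_arc chord_Suc in \<open>auto simp: gain_prefix_0 gain_prefix_Suc\<close>)

lemma gain_prefix_back: "t < k \<Longrightarrow> gain_prefix (Suc t) * \<phi> (x (Suc t), x t) = gain_prefix t"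
  using gain_mult_reverse [OF chord_arc [OF chord_Suc(1)], of t] by (simp add: gain_prefix_Suc mult.assoc)

lemma gain_prefix_segment:
  "a \<le> b \<Longrightarrow> gain_prefix b = gain_prefix a * prod_list (map (\<lambda>t. \<phi> (x t, x (Suc t))) [a..<b])"
  by (induction b rule: dec_induct) (simp_all add: gain_prefix_Suc mult.assoc)

text \<open>After switching, the chord carries the gain of its cycle, which has length
  \<open>b - a + 1\<close>. Type 1 makes this a real sign, equal to its own inverse, so it is the
  same in both directions.\<close>

lemma type1_segment:
  assumes "a + 2 \<le> b" "b \<le> k" "(x b, x a) \<in> parcs G" and t1: "\<And>C. graph_cycle G C \<Longrightarrow> type1 \<phi> C"
  shows "odd (b - a)"
    and "gain_prefix b * \<phi> (x b, x a) = (- 1) ^ ((b - a + 1) div 2) *\<^sub>R gain_prefix a"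
    and "gain_prefix a * \<phi> (x a, x b) = (- 1) ^ ((b - a + 1) div 2) *\<^sub>R gain_prefix b"
proof -
  let ?e = "(- 1) ^ ((b - a + 1) div 2) :: real"
  note T = t1 [OF graph_cycle_segment [OF assms(1-3)], unfolded type1_def]
  show "odd (b - a)" using T assms by simp
  have "prod_list (map (\<lambda>t. \<phi> (x t, x (Suc t))) [a..<b]) * \<phi> (x b, x a) = (- 1) ^ ((b - a + 1) div 2)"
    using T assms by (simp add: comp_def)
  \<comment> \<open>As a real number the sign can be moved past the quaternion
    \<open>gain_prefix a\<close>.\<close>
  also have "\<dots> = of_real ?e" by simp
  finally have *: "prod_list (map (\<lambda>t. \<phi> (x t, x (Suc t))) [a..<b]) * \<phi> (x b, x a) = of_real ?e" .
  show **: "gain_prefix b * \<phi> (x b, x a) = ?e *\<^sub>R gain_prefix a"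
  proof -
    have "gain_prefix b * \<phi> (x b, x a) = gain_prefix a * of_real ?e"
      using gain_prefix_segment [of a b] assms(1) by (simp only: mult.assoc *)
    then show ?thesis unfolding of_real_def by simp
  qed
  have "gain_prefix b = (?e *\<^sub>R gain_prefix a) * \<phi> (x a, x b)"
    using ** gain_mult_eq_iff [OF assms(3)] by simp
  then have "?e *\<^sub>R gain_prefix b = (?e * ?e) *\<^sub>R (gain_prefix a * \<phi> (x a, x b))" by simp
  moreover have "?e * ?e = 1" by (simp add: power_mult_distrib [symmetric])
  ultimately show "gain_prefix a * \<phi> (x a, x b) = ?e *\<^sub>R gain_prefix b" by simp
qed

text \<open>Undoes the switching: real weights on positions become a quaternionic vector on
  vertices.\<close>

definition lift :: "(nat \<Rightarrow> real) \<Rightarrow> 'v \<Rightarrow> quat" where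
  "lift \<sigma> v = (let t = inv_into {..k} x v in \<sigma> t *\<^sub>R gain_prefix t)"

lemma lift_x: "t \<le> k \<Longrightarrow> lift \<sigma> (x t) = \<sigma> t *\<^sub>R gain_prefix t"
  using inj_x by (simp add: lift_def)

lemma lift_eq_0_iff: "t \<le> k \<Longrightarrow> lift \<sigma> (x t) = 0 \<longleftrightarrow> \<sigma> t = 0"
  using gain_prefix_nonzero by (simp add: lift_x)

context
  assumes odd_i: "odd i" and odd_j: "odd j" and even_k: "even k"
    and type1: "\<And>C. graph_cycle G C \<Longrightarrow> type1 \<phi> C"
begin

text \<open>In the equation at \<open>x t\<close> every term is a real multiple of
  \<open>gain_prefix t\<close>: path arcs contribute plain weights, chords weights with the sign of
  their cycle. The hypotheses are the resulting real equations.\<close>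

lemma kern_lift:
  assumes start: "\<sigma> 1 + (- 1) ^ ((i + 1) div 2) * \<sigma> i = 0"
    and finish: "\<sigma> (k - 1) + (- 1) ^ ((k - j + 1) div 2) * \<sigma> j = 0"
    and interior: "\<And>t. \<lbrakk>0 < t; t < k\<rbrakk> \<Longrightarrow> \<sigma> (t - 1) + \<sigma> (t + 1) +
      (if t = i then (- 1) ^ ((i + 1) div 2) * \<sigma> 0 else 0) +
      (if t = j then (- 1) ^ ((k - j + 1) div 2) * \<sigma> k else 0) = 0"
  shows "kern (lift \<sigma>)"
  unfolding kern_iff
proof (intro allI impI)
  fix t assume t: "t \<le> k"
  let ?f = "\<lambda>s. lift \<sigma> (x s) * \<phi> (x s, x t)"
  \<comment> \<open>By parity neither chord joins \<open>0\<close> to \<open>k\<close>, so the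
    equations at the two ends have just two terms.\<close>
  have ij: "i < k" "0 < j" using odd_i odd_j even_k i_bounds by (auto simp: order_le_less odd_pos)
  have fi: "lift \<sigma> (x 0) * \<phi> (x 0, x i) = ((- 1) ^ ((i + 1) div 2) * \<sigma> 0) *\<^sub>R gain_prefix i"
      "lift \<sigma> (x i) * \<phi> (x i, x 0) = ((- 1) ^ ((i + 1) div 2) * \<sigma> i) *\<^sub>R gain_prefix 0"
    using type1_segment [of 0 i] i_bounds chord_arc chord_i type1 by (simp_all add: lift_x mult.commute)
  have fj: "lift \<sigma> (x j) * \<phi> (x j, x k) = ((- 1) ^ ((k - j + 1) div 2) * \<sigma> j) *\<^sub>R gain_prefix k"
      "lift \<sigma> (x k) * \<phi> (x k, x j) = ((- 1) ^ ((k - j + 1) div 2) * \<sigma> k) *\<^sub>R gain_prefix j"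
    using type1_segment [of j k] j_bounds chord_arc chord_j type1 by (simp_all add: lift_x mult.commute)
  have f_Suc: "lift \<sigma> (x (Suc s)) * \<phi> (x (Suc s), x s) = \<sigma> (Suc s) *\<^sub>R gain_prefix s"
      "lift \<sigma> (x s) * \<phi> (x s, x (Suc s)) = \<sigma> s *\<^sub>R gain_prefix (Suc s)" if "s < k" for s
    using that gain_prefix_back [of s] by (simp add: lift_x, simp add: lift_x gain_prefix_Suc)
  consider "t = 0" | "t = k" | "0 < t" "t < k" using t by linarith
  then show "(\<Sum>s | (s, t) \<in> \<Gamma>. ?f s) = 0"
  proof cases
    case 1
    have "{s. (s, t) \<in> \<Gamma>} = {1, i}" using 1 ij i_bounds by (auto simp: chord_arcs_def)
    then have "(\<Sum>s | (s, t) \<in> \<Gamma>. ?f s) = ?f 1 + ?f i" using i_bounds by simp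
    also have "\<dots> = (\<sigma> 1 + (- 1) ^ ((i + 1) div 2) * \<sigma> i) *\<^sub>R gain_prefix 0"
      using f_Suc [of 0] fi ij 1 by (simp add: scaleR_add_left)
    finally show ?thesis using start by simp
  next
    case 2
    have "{s. (s, t) \<in> \<Gamma>} = {k - 1, j}" using 2 ij j_bounds by (auto simp: chord_arcs_def)
    then have "(\<Sum>s | (s, t) \<in> \<Gamma>. ?f s) = ?f (k - 1) + ?f j" using j_bounds by simp
    also have "\<dots> = (\<sigma> (k - 1) + (- 1) ^ ((k - j + 1) div 2) * \<sigma> j) *\<^sub>R gain_prefix k"
      using f_Suc [of "k - 1"] fj ij 2 by (simp add: scaleR_add_left)
    finally show ?thesis using finish by simp
  next
    case 3
    \<comment> \<open>\<open>?A\<close> and \<open>?B\<close> hold the chord neighbours of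
      \<open>t\<close>; both are nonempty when \<open>i = j = t\<close>.\<close>
    let ?A = "if t = i then {0} else {}" and ?B = "if t = j then {k} else {}"
    have N: "{s. (s, t) \<in> \<Gamma>} = {t - 1, t + 1} \<union> ?A \<union> ?B"
      using 3 by (auto simp: chord_arcs_def)
    have "(\<Sum>s | (s, t) \<in> \<Gamma>. ?f s) = ?f (t - 1) + ?f (t + 1) + sum ?f ?A + sum ?f ?B"
      unfolding N using 3 i_bounds j_bounds
      by (subst sum.union_disjoint; (subst sum.union_disjoint)?; auto)
    moreover have "?f (t - 1) = \<sigma> (t - 1) *\<^sub>R gain_prefix t" "?f (t + 1) = \<sigma> (t + 1) *\<^sub>R gain_prefix t"
      using f_Suc(2) [of "t - 1"] f_Suc(1) [of t] 3 by simp_all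
    moreover have "sum ?f ?A = (if t = i then (- 1) ^ ((i + 1) div 2) * \<sigma> 0 else 0) *\<^sub>R gain_prefix t"
      using fi by simp
    moreover have "sum ?f ?B = (if t = j then (- 1) ^ ((k - j + 1) div 2) * \<sigma> k else 0) *\<^sub>R gain_prefix t"
      using fj by simp
    ultimately have "(\<Sum>s | (s, t) \<in> \<Gamma>. ?f s) = (\<sigma> (t - 1) + \<sigma> (t + 1) +
      (if t = i then (- 1) ^ ((i + 1) div 2) * \<sigma> 0 else 0) +
      (if t = j then (- 1) ^ ((k - j + 1) div 2) * \<sigma> k else 0)) *\<^sub>R gain_prefix t"
      by (simp only: scaleR_add_left)
    then show ?thesis using interior [OF 3] by simp
  qed
qed

text \<open>Consecutive odd positions carry opposite signs and cancel at the even position between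
  them. At the ends the chord signs produce the same cancellation, and at odd positions every term
  is zero.\<close>

lemma kern_lift_odd: "kern (lift (\<lambda>t. if odd t then (- 1) ^ (t div 2) else 0))"
proof (rule kern_lift)
  obtain a b d where abd: "i = 2 * a + 1" "j = 2 * b + 1" "k = 2 * d" 
    using odd_i odd_j even_k by (auto elim!: oddE evenE)
  have bd: "b < d" using abd j_bounds by simp
  have "(- 1) ^ (d - 1) = - ((- 1) ^ d :: real)" using bd by (cases d) auto
  moreover have "(- 1 :: real) ^ d = (- 1) ^ (d - b) * (- 1) ^ b" using bd by (simp flip: power_add)
  moreover have "(k - 1) div 2 = d - 1" "(k - j + 1) div 2 = d - b" "odd (k - 1)" using abd bd by auto
  ultimately show "(if odd (k - 1) then (- 1) ^ ((k - 1) div 2) else 0) +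
      (- 1) ^ ((k - j + 1) div 2) * (if odd j then (- 1) ^ (j div 2) else 0) = (0 :: real)"
    using abd by simp
  show "(if odd (1 :: nat) then (- 1) ^ (1 div 2) else 0) +
      (- 1) ^ ((i + 1) div 2) * (if odd i then (- 1) ^ (i div 2) else 0) = (0 :: real)"
    using abd by (simp flip: power_add power_mult_distrib)
  show "(if odd (t - 1) then (- 1) ^ ((t - 1) div 2) else 0) + (if odd (t + 1) then (- 1) ^ ((t + 1) div 2) else 0) +
      (if t = i then (- 1) ^ ((i + 1) div 2) * (if odd (0 :: nat) then (- 1) ^ (0 div 2) else 0) else 0) +
      (if t = j then (- 1) ^ ((k - j + 1) div 2) * (if odd k then (- 1) ^ (k div 2) else 0) else 0) = (0 :: real)"
    if t: "0 < t" for t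
  proof (cases "even t")
    case True
    then obtain q where "t = 2 * q" by (rule evenE)
    \<comment> \<open>Writing \<open>t\<close> as \<open>2 * Suc e\<close> gives its two neighbours
      the consecutive exponents \<open>e\<close> and \<open>Suc e\<close>.\<close>
    then obtain e where "t = 2 * Suc e" using t by (cases q) auto
    then show ?thesis using odd_i odd_j by auto
  next
    case False
    then show ?thesis using even_k by simp
  qed
qed

text \<open>Cutting the alternating weights off at \<open>i\<close> spoils only the equation at
  \<open>i\<close>, where \<open>i - 1\<close> has lost its partner. The chord to \<open>0\<close>
  supplies exactly the missing term.\<close>

lemma kern_lift_before: "kern (lift (\<lambda>t. if even t \<and> t < i then (- 1) ^ (t div 2) else 0))"
    (is "kern (lift ?\<sigma>)")
proof (rule kern_lift)
  show "?\<sigma> 1 + (- 1) ^ ((i + 1) div 2) * ?\<sigma> i = 0" using odd_i by simp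
  show "?\<sigma> (k - 1) + (- 1) ^ ((k - j + 1) div 2) * ?\<sigma> j = 0"
    using odd_j even_k j_bounds by simp
  show "?\<sigma> (t - 1) + ?\<sigma> (t + 1) + (if t = i then (- 1) ^ ((i + 1) div 2) * ?\<sigma> 0 else 0) +
      (if t = j then (- 1) ^ ((k - j + 1) div 2) * ?\<sigma> k else 0) = 0"
    if t: "0 < t" "t < k" for t
  proof (cases "even t")
    case True
    then have "t \<noteq> i" "t \<noteq> j" using odd_i odd_j by auto
    then show ?thesis using True t by simp
  next
    case False
    then obtain e where e: "t = 2 * e + 1" by (rule oddE)
    obtain a where a: "i = 2 * a + 1" using odd_i by (rule oddE)
    have te: "t - 1 = 2 * e" "t + 1 = 2 * Suc e" and ia: "(i + 1) div 2 = Suc a"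
        and lt: "2 * e < i \<longleftrightarrow> e \<le> a" "2 * Suc e < i \<longleftrightarrow> e < a" and ti: "t = i \<longleftrightarrow> e = a"
      using e a by auto
    have \<sigma>: "?\<sigma> (t - 1) = (if e \<le> a then (- 1) ^ e else 0)"
        "?\<sigma> (t + 1) = (if e < a then - ((- 1) ^ e) else 0)"
      unfolding te lt by simp_all
    have "?\<sigma> 0 = 1" "?\<sigma> k = 0" using i_bounds by simp_all
    then show ?thesis
      unfolding \<sigma> ia ti by (cases e a rule: linorder_cases) simp_all
  qed
qed

text \<open>The mirror image at \<open>j\<close>: the uncancelled weight at \<open>j + 1\<close> is
  balanced by the chord to \<open>k\<close>.\<close>

lemma kern_lift_after: "kern (lift (\<lambda>t. if even t \<and> j < t then (- 1) ^ (t div 2) else 0))"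
    (is "kern (lift ?\<sigma>)")
proof (rule kern_lift)
  show "?\<sigma> 1 + (- 1) ^ ((i + 1) div 2) * ?\<sigma> i = 0" using odd_i by simp
  show "?\<sigma> (k - 1) + (- 1) ^ ((k - j + 1) div 2) * ?\<sigma> j = 0"
    using odd_j even_k j_bounds by simp
  show "?\<sigma> (t - 1) + ?\<sigma> (t + 1) + (if t = i then (- 1) ^ ((i + 1) div 2) * ?\<sigma> 0 else 0) +
      (if t = j then (- 1) ^ ((k - j + 1) div 2) * ?\<sigma> k else 0) = 0"
    if t: "0 < t" "t < k" for t
  proof (cases "even t")
    case True
    then have "t \<noteq> i" "t \<noteq> j" using odd_i odd_j by auto
    then show ?thesis using True t by simp
  next
    case False
    then obtain e where e: "t = 2 * e + 1" by (rule oddE)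
    obtain b where b: "j = 2 * b + 1" using odd_j by (rule oddE)
    obtain d where d: "k = 2 * d" using even_k by (rule evenE)
    have "b < d" using b d j_bounds by simp
    then have "(- 1 :: real) ^ d = (- 1) ^ (d - b) * (- 1) ^ b" by (simp flip: power_add)
    then have "(- 1) ^ (d - b) * (- 1) ^ d = ((- 1) ^ (d - b) * (- 1) ^ (d - b)) * ((- 1) ^ b :: real)"
      by (simp only: mult.assoc)
    moreover have "(- 1) ^ (d - b) * (- 1) ^ (d - b) = (1 :: real)" by (simp flip: power_mult_distrib)
    moreover have "(k - j + 1) div 2 = d - b" using b d \<open>b < d\<close> by simp
    ultimately have \<sigma>k: "(- 1) ^ ((k - j + 1) div 2) * ?\<sigma> k = (- 1) ^ b"
      using b d \<open>b < d\<close> by simp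
    have te: "t - 1 = 2 * e" "t + 1 = 2 * Suc e"
        and lt: "j < 2 * e \<longleftrightarrow> b < e" "j < 2 * Suc e \<longleftrightarrow> b \<le> e" and tj: "t = j \<longleftrightarrow> e = b"
      using e b by auto
    have \<sigma>: "?\<sigma> (t - 1) = (if b < e then (- 1) ^ e else 0)"
        "?\<sigma> (t + 1) = (if b \<le> e then - ((- 1) ^ e) else 0)"
      unfolding te lt by simp_all
    have "?\<sigma> 0 = 0" by simp
    then show ?thesis
      unfolding \<sigma> \<sigma>k tj by (cases e b rule: linorder_cases) simp_all
  qed
qed

text \<open>An independent \<open>S\<close> with more than \<open>k - 2\<close> rows omits at most
  two positions. Three kernel vectors suffice to find a nonzero combination vanishing there, which
  contradicts independence.\<close>

lemma gain_rank_eq: "gain_rank G \<phi> + 2 = k"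
proof -
  define c1 where "c1 = lift (\<lambda>t. if odd t then (- 1) ^ (t div 2) else 0)"
  define c2 where "c2 = lift (\<lambda>t. if even t \<and> t < i then (- 1) ^ (t div 2) else 0)"
  define c3 where "c3 = lift (\<lambda>t. if even t \<and> j < t then (- 1) ^ (t div 2) else 0)"
  have kern: "kern c1" "kern c2" "kern c3"
    unfolding c1_def c2_def c3_def by (rule kern_lift_odd kern_lift_before kern_lift_after)+
  have c1: "c1 (x t) = 0 \<longleftrightarrow> even t" and c2: "c2 (x t) = 0 \<longleftrightarrow> odd t \<or> i \<le> t"
    and c3: "c3 (x t) = 0 \<longleftrightarrow> odd t \<or> t \<le> j" if "t \<le> k" for t
    using that by (auto simp: c1_def c2_def c3_def lift_eq_0_iff)
  have bound: "card S + 2 \<le> k" if S: "S \<subseteq> pverts G" "left_indep_rows (pverts G) (adj_matrix G \<phi>) S" for S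
  proof (rule ccontr)
    assume big: "\<not> card S + 2 \<le> k"
    have indep: "c (x t) = 0" if "kern c" "\<forall>v\<in>pverts G - S. c v = 0" "t \<le> k" for c t
      using S that left_indep_rows_iff [OF pair_finite_verts S(1)] pverts_eq by auto
    define T where "T = {t. t \<le> k \<and> x t \<notin> S}"
    have T: "\<forall>v\<in>pverts G - S. c v = 0" if "\<forall>t\<in>T. c (x t) = 0" for c :: "'v \<Rightarrow> quat"
      using that by (auto simp: T_def pverts_eq)
    have "pverts G - S = x ` T" by (auto simp: T_def pverts_eq)
    moreover have "inj_on x T" using inj_x by (rule inj_on_subset) (auto simp: T_def)
    ultimately have "card T = card (pverts G - S)" by (simp add: card_image)
    then have card_T: "card T \<le> 2"
      using big card_pverts S(1) finite_subset [OF S(1) pair_finite_verts] by (simp add: card_Diff_subset)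
    have fin_T: "finite T" by (simp add: T_def)
    have Tk: "t \<le> k" if "t \<in> T" for t using that by (simp add: T_def)
    have ends: "c1 (x 1) \<noteq> 0" "c2 (x 0) \<noteq> 0" "c2 (x k) = 0" "c3 (x k) \<noteq> 0"
      using c1 c2 c3 i_bounds j_bounds even_k by auto
    show False
    \<comment> \<open>If \<open>T\<close> has only even positions, \<open>c1\<close> vanishes on it.
      Otherwise \<open>T\<close> contains an odd position, where \<open>c2\<close> and
      \<open>c3\<close> vanish, and at most one more condition remains.\<close>
    proof (cases "\<forall>t\<in>T. even t")
      case True
      then show False using indep [OF kern(1) T, of 1] c1 Tk ends i_bounds by auto
    next
      case False
      then obtain a where a: "a \<in> T" "odd a" by blast
      have "card (T - {a}) \<le> 1" using card_T a fin_T by simp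
      \<comment> \<open>If \<open>T\<close> is just \<open>{a}\<close>, then \<open>b\<close> may
        lie outside \<open>T\<close>; hence the guards \<open>b \<in> T\<close> below.\<close>
      then obtain b where b: "T - {a} \<subseteq> {b}"
        using fin_T by (metis card_le_Suc0_iff_eq One_nat_def finite_Diff insert_iff subsetI)
      have vanish: "\<forall>t\<in>T. c (x t) = 0" if "c (x a) = 0" "b \<in> T \<Longrightarrow> c (x b) = 0" for c :: "'v \<Rightarrow> quat"
        using that b by (metis Diff_iff empty_iff insert_iff subsetD)
      have a0: "c2 (x a) = 0" "c3 (x a) = 0" using a Tk c2 c3 by auto
      show False
      proof (cases "b \<in> T \<longrightarrow> c2 (x b) = 0")
        case True
        then show False using indep [OF kern(2) T [OF vanish], of 0] a0 ends by auto
      next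
        case False
        \<comment> \<open>Eliminate position \<open>b\<close> between the two vectors supported on even positions.\<close>
        let ?c = "\<lambda>v. c3 v + (- (c3 (x b) * inverse (c2 (x b)))) * c2 v"
        have "?c (x a) = 0" "?c (x b) = 0" using a0 False by (simp_all add: mult.assoc)
        then have "\<forall>v\<in>pverts G - S. ?c v = 0" by (intro T vanish)
        \<comment> \<open>This is the contradiction: \<open>c2\<close> vanishes at
          \<open>x k\<close>, so the value of \<open>?c\<close> there is that of \<open>c3\<close>,
          which is nonzero.\<close>
        then have "?c (x k) = 0" by (intro indep left_kernel_add_mult kern order_refl)
        then show False using ends by simp
      qed
    qed
  qed
  have "\<forall>S\<subseteq>pverts G. left_indep_rows (pverts G) (adj_matrix G \<phi>) S \<longrightarrow> card S \<le> k - 2"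
  proof (intro allI impI)
    fix S assume "S \<subseteq> pverts G" "left_indep_rows (pverts G) (adj_matrix G \<phi>) S"
    then have "card S + 2 \<le> k" by (rule bound)
    then show "card S \<le> k - 2" by simp
  qed
  then have "gain_rank G \<phi> \<le> k - 2"
    unfolding gain_rank_def row_left_rank_le_iff [OF pair_finite_verts] .
  then show ?thesis using rank_ge i_bounds by simp
qed

end

end

section \<open>The characterisation of rank n - 3\<close>

theorem theorem5p7:
  fixes G :: "'v pair_pre_digraph" and \<phi> :: "'v \<times> 'v \<Rightarrow> quat" and n :: nat
  assumes "quat_gain_graph G \<phi>"
    and "Digraph_Component.connected (with_proj G)"
    and "card (pverts G) = n"
    and "pendant_number G = 0"
    and "cyclomatic_number G = 2"
  shows "(int (gain_rank G \<phi>) = int n - 2 * cyclomatic_number G + 1 \<and>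
          int n - 2 * cyclomatic_number G + 1 = int n - 3) \<longleftrightarrow>
         ((\<exists>p l q. is_infinity G p l q \<and> odd l \<and> (\<forall>C. graph_cycle G C \<longrightarrow> type1 \<phi> C)) \<or>
          (\<exists>p l q. is_theta G p l q \<and> odd p \<and> odd l \<and> odd q \<and>
                   (\<forall>C. graph_cycle G C \<longrightarrow> type1 \<phi> C)))"
    (is "?rank \<longleftrightarrow> ?inf \<or> ?theta")
proof
  interpret quat_gain_graph G \<phi> by fact
  have wf: "pair_wf_digraph G" by unfold_locales
  {
    assume rank: ?rank
    have "bicyclic_relation (pverts G) (parcs G)"
      by (rule bicyclic_relation_parcs) fact+
    then obtain k i j x where ij: "2 \<le> i" "i \<le> k" "j + 2 \<le> k" and x: "inj_on x {..k}"
        "pverts G = x ` {..k}" "parcs G = map_prod x x ` chord_arcs k i j"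
      by (rule bicyclic_relation.chord_form)
    interpret chord_gain_graph G \<phi> k i j x
      by unfold_locales (use x ij in \<open>auto simp: has_chord_form_def\<close>)
    have "gain_rank G \<phi> + 2 = k"
      using rank assms(3,5) card_pverts by simp
    note par = parity_type1 [OF this]
    show "?inf \<or> ?theta"
    proof (cases "i \<le> j")
      case True
      define m where "m = j - i"
      define r where "r = k - j"
      have mr: "k = i + m + r" "j = i + m" "2 \<le> r" using True ij by (auto simp: m_def r_def)
      have "\<exists>x. has_chord_form G (i + m + r) i (i + m) x" using form mr by auto
      then have "digraph_iso (with_proj G) (with_proj (infinity_graph (Suc i) (Suc m) (Suc r)))"
        using infinity_chord_form [of i r m] digraph_iso_chord_form [OF wf] ij mr by blast
      then have "is_infinity G (Suc i) (Suc m) (Suc r)"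
        using ij mr by (simp add: is_infinity_def)
      moreover have "odd (Suc m)" using par mr by simp
      ultimately show ?thesis using par(4) by blast
    next
      case False
      \<comment> \<open>Three paths join \<open>x j\<close> and \<open>x i\<close>: \<open>p\<close>
        counts the inner vertices between them on the Hamiltonian path; the other two, with
        \<open>j\<close> and \<open>q\<close> inner vertices, use the stretches before
        \<open>x j\<close> and after \<open>x i\<close>.\<close>
      define p where "p = i - j - 1"
      define q where "q = k - i"
      have pq: "k = j + p + q + 1" "i = j + p + 1" using False ij by (auto simp: p_def q_def)
      have odds: "odd p" "odd j" "odd q" using par pq by auto
      have "\<exists>x. has_chord_form G (j + p + q + 1) (j + p + 1) j x" using form pq by auto
      then have "digraph_iso (with_proj G) (with_proj (theta_graph p j q))"
        using theta_chord_form [of p j q] digraph_iso_chord_form [OF wf] by blast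
      then have "is_theta G p j q"
        using odds by (auto simp: is_theta_def)
      then show ?thesis using odds par(4) by blast
    qed
  next
    assume "?inf \<or> ?theta"
    then have "\<exists>k i j x. chord_gain_graph G \<phi> k i j x \<and> odd i \<and> odd j \<and> even k \<and>
        (\<forall>C. graph_cycle G C \<longrightarrow> type1 \<phi> C)"
    proof
      assume ?inf
      then obtain p l q where pq: "3 \<le> p" "3 \<le> q" "1 \<le> l" "odd l"
          and iso: "digraph_iso (with_proj G) (with_proj (infinity_graph p l q))"
          and t1: "\<And>C. graph_cycle G C \<Longrightarrow> type1 \<phi> C"
        by (auto simp: is_infinity_def)
      define i m r where "i = p - 1" and "m = l - 1" and "r = q - 1"
      have eq: "p = Suc i" "l = Suc m" "q = Suc r" and ir: "2 \<le> i" "2 \<le> r" and m: "even m"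
        using pq by (auto simp: i_def m_def r_def)
      obtain x where x: "has_chord_form G (i + m + r) i (i + m) x"
        using infinity_chord_form [OF ir, of m] digraph_iso_chord_form [OF wf] iso eq by blast
      interpret chord_gain_graph G \<phi> "i + m + r" i "i + m" x
        by unfold_locales (use x ir in auto)
      \<comment> \<open>The two cycles have \<open>i + 1\<close> and \<open>r + 1\<close> vertices,
        and Type 1 cycles have even length.\<close>
      have "odd i" using type1_segment(1) [of 0 i] ir chord_arc chord_i t1 by simp
      moreover have "odd r"
        using type1_segment(1) [of "i + m" "i + m + r"] ir chord_arc chord_j t1 by simp
      ultimately show ?thesis
        using chord_gain_graph_axioms t1 m by (metis even_add)
    next
      assume ?theta
      then obtain p l q where pq: "odd p" "odd l" "odd q"
          and iso: "digraph_iso (with_proj G) (with_proj (theta_graph p l q))"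
          and t1: "\<And>C. graph_cycle G C \<Longrightarrow> type1 \<phi> C"
        by (auto simp: is_theta_def)
      obtain x where x: "has_chord_form G (l + p + q + 1) (l + p + 1) l x"
        using theta_chord_form [of p l q] digraph_iso_chord_form [OF wf] iso by blast
      \<comment> \<open>Positivity of \<open>p\<close> provides the bounds \<open>2 \<le> i\<close>
        and \<open>j + 2 \<le> k\<close> of the chord form.\<close>
      have "0 < p" using pq by (simp add: odd_pos)
      then have "chord_gain_graph G \<phi> (l + p + q + 1) (l + p + 1) l x"
        by unfold_locales (use x in auto)
      moreover have "odd (l + p + 1)" "even (l + p + q + 1)" using pq by auto
      ultimately show ?thesis using pq t1 by blast
    qed
    then obtain k i j x where cg: "chord_gain_graph G \<phi> k i j x" and par: "odd i" "odd j" "even k"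
        and t1: "\<And>C. graph_cycle G C \<Longrightarrow> type1 \<phi> C" by blast
    interpret chord_gain_graph G \<phi> k i j x by fact
    have "gain_rank G \<phi> + 2 = k" by (rule gain_rank_eq [OF par t1])
    then show ?rank
      using assms(3,5) card_pverts by simp
  }
qed

end
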